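(* Fix $l\in\{0,\dots,d-1\}$ and $0\ne\alpha\in A_{\infty_1}$, and let $\varepsilon=\varepsilon_{N,l}$ be sufficiently small. Then for all $z\in\mathbf C_\infty$, \[e_\varepsilon(\alpha z)=\alpha\exp_{\widetilde\Lambda_{\varepsilon,\alpha}(f)}(z)\prod_{\lambda}\Big(1-\frac{\exp_{\widetilde\Lambda_{\varepsilon,\alpha}(f)}(z)}{\exp_{\widetilde\Lambda_{\varepsilon,\alpha}(f)}(\lambda)}\Big),\] the product running over a set of representatives $\lambda$ of the nonzero classes of $\alpha^{-1}\breve\Lambda_\varepsilon(f)/\widetilde\Lambda_{\varepsilon,\alpha}(f)$ (a finite set).
   Context: $q$ a power of a prime $p$, $A=\mathbb F_q[T]$, $k_\infty=\mathbb F_q((1/T))$ with $|T|=q$, $\mathbf C_\infty$ the completion of an algebraic closure; $\deg x=\log_q|x|$, ${\rm sgn}$ the leading $1/T$-coefficient. $a\in A$ monic of degree $d\ge1$, $b\in\mathbb F_q^\times$, $f$ the root of $X^2-aX-b$ with $|f|=q^d$; $A_{\infty_1}=\mathbb F_q[f,fT,\dots,fT^{d-1}]$, $\mathfrak a_i=(f,\dots,fT^i)$. $\Lambda_\varepsilon(f)=\{x\in A:|xf-y|<\varepsilon\text{ for some }y\in A\}$; $\varepsilon_{N,l}=q^{-dN-l}$. Periods: $\pi=f^{-1/d}$ if $p\nmid d$, $(fT)^{-1/(d+1)}$ otherwise; for $\Lambda$ a $\Lambda_\varepsilon(f)$ or $\mathfrak a_i$, $\eta_\Lambda=\lim_M\prod_{\deg\lambda=M}{\rm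 sgn}\lambda$, $t_\Lambda=(q-1)Z_\Lambda'(1)$ with $Z_\Lambda(u)=\sum_{0\neq\lambda}u^{\deg\lambda}$, $u_\Lambda=\lim_M\prod_{\deg\lambda\le M}\lambda\pi^{\deg\lambda}/{\rm sgn}\lambda$ (over nonzero $\lambda\in\Lambda$), $\xi_\Lambda^{q-1}=\eta_\Lambda^{-1}\pi^{-t_\Lambda}u_\Lambda^{q-1}$; $\xi_\varepsilon=\xi_{\Lambda_\varepsilon(f)}$, $\xi_i=\xi_{\mathfrak a_i}$. $\breve\Lambda_\varepsilon(f)=\xi_\varepsilon\Lambda_\varepsilon(f)$; for $\varepsilon=\varepsilon_{N,l}$, $\delta=q^{-dN}\varepsilon|\xi_{d-1-l}|$ and $\widetilde\Lambda_{\varepsilon,\alpha}(f)=\{x\in\alpha^{-1}\breve\Lambda_\varepsilon(f):{\rm dist}(x,\breve\Lambda_\varepsilon(f))<\delta\}$. For a discrete $\mathbb F_q$-subspace $L\subset\mathbf C_\infty$, $\exp_L(z)=z\prod_{0\neq\lambda\in L}(1-z/\lambda)$, and $e_\varepsilon=\exp_{\breve\Lambda_\varepsilon(f)}$. *)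

theory Defs
  imports "HOL-Analysis.Analysis" "HOL-Algebra.Algebraic_Closure_Type"
begin

text \<open>
  The finite field is a type \<open>'a :: {field, finite}\<close>, so that \<open>q = CARD('a)\<close> and \<open>p = CHAR('a)\<close>.
  The completion of its rational function field at infinity is \<open>'a fls\<close>, where the formal
  variable stands for \<open>1/T\<close>; thus \<open>T\<close> is \<open>fls_X_inv\<close>. The library metric on \<open>'a fls\<close> has base 2
  instead of base \<open>q\<close>, but induces the same topology; it is used only for the limits defining
  \<open>eta_limit\<close> and \<open>u_limit\<close>.
\<close>

definition vabs :: "'a::{field,finite} fls \<Rightarrow> real" where
  "vabs x = (if x = 0 then 0 else real CARD('a) powi (- fls_subdegree x))"

text \<open>For \<open>x \<noteq> 0\<close> this is the logarithm of \<open>vabs x\<close> to base \<open>q\<close>.\<close>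
definition vdeg :: "'a::{field,finite} fls \<Rightarrow> int" where
  "vdeg x = - fls_subdegree x"

definition lead_sgn :: "'a::{field,finite} fls \<Rightarrow> 'a" where
  "lead_sgn x = fls_nth x (fls_subdegree x)"

definition of_A :: "'a::{field,finite} poly \<Rightarrow> 'a fls" where
  "of_A P = poly (map_poly fls_const P) fls_X_inv"

definition cabs :: "'c::{zero,metric_space} \<Rightarrow> real" where
  "cabs v = dist v 0"

text \<open>
  A type \<open>'c\<close> together with an embedding \<open>j\<close> of an algebraic closure is a completion of that
  algebraic closure with respect to the extension of the absolute value.
  Completeness is part of the sort of \<open>'c\<close>. The absolute value of \<open>'c\<close> is \<open>cabs\<close>, since the
  constant \<open>norm\<close> is tied to real vector spaces.
\<close>
locale completed_alg_closure =
  fixes j :: "'a::{field,finite} fls alg_closure \<Rightarrow> 'c::{field,complete_space}"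
  assumes j_one: "j 1 = 1"
    and j_add: "j (x + y) = j x + j y"
    and j_mult: "j (x * y) = j x * j y"
    and dist_eq_cabs: "dist v w = cabs (v - w :: 'c)"
    and cabs_mult: "cabs (v * w :: 'c) = cabs v * cabs w"
    and cabs_ultrametric: "cabs (v + w :: 'c) \<le> max (cabs v) (cabs w)"
    and cabs_extends: "cabs (j (to_ac s)) = vabs s"
    and dense_range: "closure (range j) = UNIV"

inductive_set A_inf1 :: "'a::{field,finite} fls \<Rightarrow> nat \<Rightarrow> 'a fls set"
  for f :: "'a fls" and d :: nat where
  const: "fls_const c \<in> A_inf1 f d"
| gen: "i < d \<Longrightarrow> f * fls_X_inv ^ i \<in> A_inf1 f d"
| add: "x \<in> A_inf1 f d \<Longrightarrow> y \<in> A_inf1 f d \<Longrightarrow> x + y \<in> A_inf1 f d"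
| mult: "x \<in> A_inf1 f d \<Longrightarrow> y \<in> A_inf1 f d \<Longrightarrow> x * y \<in> A_inf1 f d"

definition ideal_a :: "'a::{field,finite} fls \<Rightarrow> nat \<Rightarrow> nat \<Rightarrow> 'a fls set" where
  "ideal_a f d i = {\<Sum>k\<le>i. c k * (f * fls_X_inv ^ k) | c. \<forall>k\<le>i. c k \<in> A_inf1 f d}"

definition Lambda :: "'a::{field,finite} fls \<Rightarrow> real \<Rightarrow> 'a fls set" where
  "Lambda f \<epsilon> = {x \<in> range of_A. \<exists>y\<in>range of_A. vabs (x * f - y) < \<epsilon>}"

definition eta_limit :: "'a::{field,finite} fls set \<Rightarrow> 'a fls" where
  "eta_limit \<Lambda> = lim (\<lambda>M::nat. \<Prod>x\<in>{x \<in> \<Lambda> - {0}. vdeg x = int M}. fls_const (lead_sgn x))"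

definition u_limit :: "'a::{field,finite} fls \<Rightarrow> 'a fls set \<Rightarrow> 'a fls" where
  "u_limit \<pi> \<Lambda> = lim (\<lambda>M::nat. \<Prod>x\<in>{x \<in> \<Lambda> - {0}. vdeg x \<le> int M}.
     x * \<pi> powi (vdeg x) / fls_const (lead_sgn x))"

definition zeta_fps :: "'a::{field,finite} fls set \<Rightarrow> real fps" where
  "zeta_fps \<Lambda> = Abs_fps (\<lambda>n. real (card {x \<in> \<Lambda> - {0}. vdeg x = int n}))"

text \<open>
  The point 1 lies outside the disc of convergence: the derivative there is that of the rational
  function \<open>P/Q\<close> whose expansion at 0 is the given power series.
\<close>
definition zeta_deriv_1 :: "'a::{field,finite} fls set \<Rightarrow> real" where
  "zeta_deriv_1 \<Lambda> = (THE z. \<exists>P Q :: real poly.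
     poly Q 0 \<noteq> 0 \<and> poly Q 1 \<noteq> 0 \<and> zeta_fps \<Lambda> * fps_of_poly Q = fps_of_poly P \<and>
     ((\<lambda>u. poly P u / poly Q u) has_real_derivative z) (at 1))"

definition t_exponent :: "'a::{field,finite} fls set \<Rightarrow> int" where
  "t_exponent \<Lambda> = (THE t. real_of_int t = (real CARD('a) - 1) * zeta_deriv_1 \<Lambda>)"

text \<open>The root \<open>\<xi>\<close> is determined only up to a factor in the multiplicative group of the finite field.\<close>
definition is_period ::
  "('a::{field,finite} fls alg_closure \<Rightarrow> 'c::field) \<Rightarrow> 'a fls \<Rightarrow> 'a fls set \<Rightarrow> 'c \<Rightarrow> bool" where
  "is_period j \<pi> \<Lambda> \<xi> \<longleftrightarrow>
     \<xi> ^ (CARD('a) - 1) =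
       j (to_ac (inverse (eta_limit \<Lambda>) * \<pi> powi (- t_exponent \<Lambda>) * u_limit \<pi> \<Lambda> ^ (CARD('a) - 1)))"

text \<open>The infinite product is the limit of the net of all finite subproducts.\<close>
definition exp_lattice :: "'c::{field,t2_space} set \<Rightarrow> 'c \<Rightarrow> 'c" where
  "exp_lattice L z = z * Lim (finite_subsets_at_top (L - {0})) (\<lambda>F. \<Prod>w\<in>F. 1 - z / w)"

definition eps_Nl :: "nat \<Rightarrow> nat \<Rightarrow> nat \<Rightarrow> nat \<Rightarrow> real" where
  "eps_Nl q d N l = real q powi (- int (d * N + l))"

definition Lambda_breve ::
  "('a::{field,finite} fls alg_closure \<Rightarrow> 'c::field) \<Rightarrow> ('a fls set \<Rightarrow> 'c) \<Rightarrow> 'a fls \<Rightarrow> real \<Rightarrow> 'c set" where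
  "Lambda_breve j \<xi> f \<epsilon> = (\<lambda>x. \<xi> (Lambda f \<epsilon>) * j (to_ac x)) ` Lambda f \<epsilon>"

definition scaled :: "'c::field \<Rightarrow> 'c set \<Rightarrow> 'c set" where
  "scaled \<alpha> L = (\<lambda>x. inverse \<alpha> * x) ` L"

definition Lambda_tilde :: "'c::{field,metric_space} \<Rightarrow> real \<Rightarrow> 'c set \<Rightarrow> 'c set" where
  "Lambda_tilde \<alpha> \<delta> L = {x \<in> scaled \<alpha> L. infdist x L < \<delta>}"

definition coset_rel :: "'c::field set \<Rightarrow> 'c set \<Rightarrow> ('c \<times> 'c) set" where
  "coset_rel M L = {(x, y). x \<in> M \<and> y \<in> M \<and> x - y \<in> L}"

definition nonzero_class_reps :: "'c::field set \<Rightarrow> 'c set \<Rightarrow> 'c set \<Rightarrow> bool" where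
  "nonzero_class_reps M L R \<longleftrightarrow> R \<subseteq> M - L \<and> (\<forall>x\<in>M - L. \<exists>!r. r \<in> R \<and> (r, x) \<in> coset_rel M L)"

end

theory Submission
  imports Defs
begin

text \<open>
  Write \<open>M\<close> for \<open>\<alpha>\<^sup>-\<^sup>1 L\<close> and \<open>L'\<close> for the subgroup of its elements at distance less than \<open>\<delta>\<close> from \<open>L\<close>.
  Since \<open>exp_L(\<alpha>z) = \<alpha> exp_M(z)\<close>, the claim is that \<open>exp_M\<close> is the polynomial
  \<open>X \<Prod>(1 - X/exp_L'(\<lambda>))\<close> in \<open>exp_L'\<close>. For finite groups this follows from the additivity of the
  exponential, by collecting the factors \<open>1 - z/w\<close> of \<open>exp_M\<close> according to the cosets of \<open>L'\<close>; the
  general case is the limit over the finite groups of elements of bounded absolute value.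

  The index of \<open>L'\<close> in \<open>M\<close> is finite for every \<open>\<delta> > 0\<close>, because \<open>\<Lambda>\<close> is the kernel of a map from \<open>A\<close> to
  a finite set of coefficients. That \<open>\<delta> > 0\<close> means that the period of the ideal does not vanish, so
  the limits defining it have to be shown to exist and to be nonzero. Grouping the elements of degree
  \<open>n\<close> into orbits under scaling and under translation by the elements of small degree,
  the products over a single degree are constant for \<open>\<eta>\<close> and tend to 1 for \<open>u\<close>.
\<close>

section \<open>Additive subgroups\<close>

definition add_subgroup :: "'b::ab_group_add set \<Rightarrow> bool" where
  "add_subgroup V \<longleftrightarrow> 0 \<in> V \<and> (\<forall>x\<in>V. \<forall>y\<in>V. x - y \<in> V)"

lemma add_subgroup_zero: "add_subgroup V \<Longrightarrow> 0 \<in> V"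
  and add_subgroup_diff: "add_subgroup V \<Longrightarrow> x \<in> V \<Longrightarrow> y \<in> V \<Longrightarrow> x - y \<in> V"
  by (auto simp: add_subgroup_def)

lemma add_subgroup_uminus: "add_subgroup V \<Longrightarrow> x \<in> V \<Longrightarrow> - x \<in> V"
  using add_subgroup_diff[of V 0 x] by (simp add: add_subgroup_zero)

lemma add_subgroup_add: "add_subgroup V \<Longrightarrow> x \<in> V \<Longrightarrow> y \<in> V \<Longrightarrow> x + y \<in> V"
  using add_subgroup_diff[of V x "- y"] by (simp add: add_subgroup_uminus)

lemma add_subgroup_translate:
  assumes "add_subgroup V" "y \<in> V"
  shows "bij_betw (\<lambda>v. v - y) V V"
  by (rule bij_betwI[where g = "\<lambda>v. v + y"])
    (use assms in \<open>auto intro: add_subgroup_diff add_subgroup_add\<close>)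

section \<open>The exponential of a finite group\<close>

text \<open>Let \<open>P\<close> be the monic polynomial with root set \<open>V\<close>. Since
  \<open>P\<close> is invariant under translation by \<open>V\<close>, the polynomials
  \<open>P(X + y)\<close> and \<open>P(X) + P(y)\<close> agree on the \<open>card V\<close> points
  of \<open>V\<close>; they also share degree and leading coefficient.\<close>

lemma prod_diff_subgroup_additive:
  fixes V :: "'b::field set"
  assumes V: "add_subgroup V" "finite V"
  shows "(\<Prod>v\<in>V. (x + y) - v) = (\<Prod>v\<in>V. x - v) + (\<Prod>v\<in>V. y - v)"
proof -
  define P where "P = (\<Prod>v\<in>V. [:- v, 1:])"
  have evP: "poly P t = (\<Prod>v\<in>V. t - v)" for t
    by (simp add: P_def poly_prod)
  have degP: "Polynomial.degree P = card V"
    unfolding P_def by (subst degree_prod_eq_sum_degree) auto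
  have lcP: "Polynomial.lead_coeff P = 1"
    unfolding P_def by (simp add: lead_coeff_prod)
  have card_pos: "card V > 0"
    using V add_subgroup_zero card_gt_0_iff by blast
  define Q where "Q = pcompose P [:y, 1:]"
  have degQ: "Polynomial.degree Q = card V"
    by (simp add: Q_def degree_pcompose degP)
  have lcQ: "Polynomial.lead_coeff Q = 1"
    by (simp add: Q_def lead_coeff_comp lcP)
  have "Q = P + [:poly P y:]"
  proof (rule poly_eqI_degree_lead_coeff[where n = "card V" and A = V])
    have "poly.coeff [:poly P y:] (card V) = 0"
      using card_pos by (intro coeff_eq_0) auto
    with lcP lcQ degP degQ show "poly.coeff Q (card V) = poly.coeff (P + [:poly P y:]) (card V)"
      by simp
    show "Polynomial.degree (P + [:poly P y:]) \<le> card V"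
      by (intro degree_add_le) (auto simp: degP)
    fix z assume z: "z \<in> V"
    have "poly P z = 0"
      unfolding evP using z V by auto
    moreover have "poly P (z + y) = poly P y"
      unfolding evP
      using prod.reindex_bij_betw[OF add_subgroup_translate[OF V(1) z], of "\<lambda>v. y - v"]
      by (simp add: algebra_simps)
    ultimately show "poly Q z = poly (P + [:poly P y:]) z"
      by (simp add: Q_def poly_pcompose add.commute)
  qed (auto simp: degQ)
  then have "poly Q x = poly P x + poly P y"
    by simp
  then show ?thesis
    by (simp add: Q_def poly_pcompose evP add.commute)
qed

lemma exp_lattice_finite:
  assumes "finite V"
  shows "exp_lattice V z = z * (\<Prod>w\<in>V - {0}. 1 - z / w)"
proof -
  have "((\<lambda>F. \<Prod>w\<in>F. 1 - z / w) \<longlongrightarrow> (\<Prod>w\<in>V - {0}. 1 - z / w)) (finite_subsets_at_top (V - {0}))"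
    by (rule tendsto_eventually) (use assms in \<open>simp add: eventually_finite_subsets_at_top_finite\<close>)
  then show ?thesis
    unfolding exp_lattice_def by (simp add: tendsto_Lim)
qed

text \<open>Up to a constant factor the exponential is the additive polynomial with root set
  \<open>V\<close>; additivity and the zero set are read off from this form.\<close>

lemma exp_lattice_finite_altdef:
  assumes V: "add_subgroup V" "finite V"
  shows "exp_lattice V z = (\<Prod>v\<in>V. z - v) / (\<Prod>v\<in>V - {0}. - v)"
proof -
  have "(\<Prod>v\<in>V. z - v) = z * (\<Prod>v\<in>V - {0}. z - v)"
    using prod.remove[OF V(2) add_subgroup_zero[OF V(1)], of "\<lambda>v. z - v"] by simp
  moreover have "(\<Prod>v\<in>V - {0}. z - v) / (\<Prod>v\<in>V - {0}. - v) = (\<Prod>v\<in>V - {0}. 1 - z / v)"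
    unfolding prod_dividef[symmetric] by (intro prod.cong) (auto simp: field_simps)
  ultimately show ?thesis
    using V(2) by (simp add: exp_lattice_finite flip: times_divide_eq_right)
qed

lemma exp_lattice_finite_diff:
  assumes V: "add_subgroup V" "finite V"
  shows "exp_lattice V (x - y) = exp_lattice V x - exp_lattice V y"
  using prod_diff_subgroup_additive[OF V, of "x - y" y]
  by (simp add: exp_lattice_finite_altdef[OF V] diff_divide_distrib[symmetric])

lemma exp_lattice_finite_eq_0_iff:
  assumes V: "add_subgroup V" "finite V"
  shows "exp_lattice V z = 0 \<longleftrightarrow> z \<in> V"
  using V(2) by (auto simp: exp_lattice_finite_altdef[OF V])

text \<open>By additivity the left side is \<open>exp_lattice V (r - z) / exp_lattice V r\<close>,
  which splits into one factor for each element of the coset of \<open>r\<close>; the sign is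
  absorbed by the symmetry of \<open>V\<close>.\<close>

lemma one_minus_exp_lattice_quotient:
  assumes V: "add_subgroup V" "finite V" and r: "r \<notin> V"
  shows "1 - exp_lattice V z / exp_lattice V r = (\<Prod>v\<in>V. 1 - z / (r + v))"
proof -
  have "exp_lattice V r \<noteq> 0"
    using exp_lattice_finite_eq_0_iff[OF V] r by blast
  then have "1 - exp_lattice V z / exp_lattice V r = exp_lattice V (r - z) / exp_lattice V r"
    by (simp add: exp_lattice_finite_diff[OF V] diff_divide_distrib)
  also have "\<dots> = (\<Prod>v\<in>V. r - z - v) / (\<Prod>v\<in>V. r - v)"
    using V(2) by (simp add: exp_lattice_finite_altdef[OF V])
  also have "\<dots> = (\<Prod>v\<in>V. 1 - z / (r - v))"
    unfolding prod_dividef[symmetric]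
  proof (intro prod.cong refl)
    fix v assume "v \<in> V"
    with r have "r - v \<noteq> 0" by auto
    then show "(r - z - v) / (r - v) = 1 - z / (r - v)"
      by (simp add: divide_simps)
  qed
  also have "\<dots> = (\<Prod>v\<in>V. 1 - z / (r + v))"
    by (rule prod.reindex_bij_witness[where i = uminus and j = uminus])
      (use V in \<open>auto intro: add_subgroup_uminus\<close>)
  finally show ?thesis .
qed

text \<open>Serves to rearrange a product over \<open>M - L\<close> coset by coset.\<close>

lemma nonzero_class_reps_bij:
  assumes M: "add_subgroup M" and L: "L \<subseteq> M" "add_subgroup L" and R: "nonzero_class_reps M L R"
  shows "bij_betw (\<lambda>(r, v). r + v) (R \<times> L) (M - L)"
  unfolding bij_betw_def
proof
  have RM: "r \<in> M" "r \<notin> L" if "r \<in> R" for r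
    using R that by (auto simp: nonzero_class_reps_def)
  have uniq: "\<exists>!r. r \<in> R \<and> (r, x) \<in> coset_rel M L" if "x \<in> M - L" for x
    using R that by (auto simp: nonzero_class_reps_def)
  have mem: "r + v \<in> M - L" if "r \<in> R" "v \<in> L" for r v
    using RM[OF that(1)] that L add_subgroup_add[OF M, of r v] add_subgroup_diff[OF L(2), of "r + v" v]
    by auto
  have rel: "(r, r + v) \<in> coset_rel M L" if "r \<in> R" "v \<in> L" for r v
    using RM[OF that(1)] mem[OF that] that add_subgroup_uminus[OF L(2), of v]
    by (auto simp: coset_rel_def)
  show "inj_on (\<lambda>(r, v). r + v) (R \<times> L)"
  proof (rule inj_onI; clarify)
    fix r v r' v' assume *: "r \<in> R" "v \<in> L" "r' \<in> R" "v' \<in> L" "r + v = r' + v'"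
    then have "r = r'"
      using uniq[OF mem[OF *(1,2)]] rel[OF *(1,2)] rel[OF *(3,4)] by metis
    with * show "r = r' \<and> v = v'" by simp
  qed
  show "(\<lambda>(r, v). r + v) ` (R \<times> L) = M - L"
  proof
    show "(\<lambda>(r, v). r + v) ` (R \<times> L) \<subseteq> M - L"
      using mem by auto
    show "M - L \<subseteq> (\<lambda>(r, v). r + v) ` (R \<times> L)"
    proof
      fix x assume x: "x \<in> M - L"
      then obtain r where r: "r \<in> R" "(r, x) \<in> coset_rel M L"
        using uniq by blast
      then have "x - r \<in> L"
        using add_subgroup_uminus[OF L(2), of "r - x"] by (auto simp: coset_rel_def)
      with r show "x \<in> (\<lambda>(r, v). r + v) ` (R \<times> L)"
        by (intro image_eqI[of _ _ "(r, x - r)"]) auto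
    qed
  qed
qed

text \<open>The factors of \<open>exp_lattice M\<close> indexed by \<open>L\<close> give
  \<open>exp_lattice L\<close>; those in the coset of a representative \<open>w\<close> give the
  outer factor at \<open>w\<close>.\<close>

lemma exp_lattice_quotient_finite:
  fixes M :: "'b::{field,t2_space} set"
  assumes M: "add_subgroup M" "finite M" and L: "L \<subseteq> M" "add_subgroup L"
    and R: "nonzero_class_reps M L R"
  shows "exp_lattice M z
    = exp_lattice L z * (\<Prod>w\<in>R. 1 - exp_lattice L z / exp_lattice L w)"
proof -
  have finL: "finite L" using L(1) M(2) finite_subset by blast
  have RM: "r \<notin> L" if "r \<in> R" for r
    using R that by (auto simp: nonzero_class_reps_def)
  have "(\<Prod>w\<in>R. 1 - exp_lattice L z / exp_lattice L w) = (\<Prod>w\<in>R. \<Prod>v\<in>L. 1 - z / (w + v))"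
    using one_minus_exp_lattice_quotient[OF L(2) finL] RM by simp
  also have "\<dots> = (\<Prod>(r, v)\<in>R \<times> L. 1 - z / (r + v))"
    by (rule prod.cartesian_product)
  also have "\<dots> = (\<Prod>w\<in>M - L. 1 - z / w)"
    using prod.reindex_bij_betw[OF nonzero_class_reps_bij[OF M(1) L R], of "\<lambda>w. 1 - z / w"]
    by (simp add: case_prod_unfold)
  finally have "(\<Prod>w\<in>R. 1 - exp_lattice L z / exp_lattice L w) = (\<Prod>w\<in>M - L. 1 - z / w)" .
  moreover have "(\<Prod>w\<in>M - {0}. 1 - z / w) = (\<Prod>w\<in>M - L. 1 - z / w) * (\<Prod>w\<in>L - {0}. 1 - z / w)"
  proof -
    have "M - {0} = (M - L) \<union> (L - {0})"
      using L add_subgroup_zero by auto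
    then show ?thesis
      using M(2) finL prod.union_disjoint[of "M - L" "L - {0}" "\<lambda>w. 1 - z / w"] by auto
  qed
  ultimately show ?thesis
    using M(2) finL by (simp add: exp_lattice_finite)
qed

text \<open>Scaling the index set turns one net of finite products into the other, so the identity
  holds whether or not the products converge.\<close>

lemma exp_lattice_scaled:
  fixes \<alpha> :: "'b::{field,t2_space}"
  assumes "\<alpha> \<noteq> 0"
  shows "exp_lattice L (\<alpha> * z) = \<alpha> * exp_lattice (scaled \<alpha> L) z"
proof -
  let ?s = "\<lambda>x. inverse \<alpha> * x"
  have inj: "inj_on ?s A" for A
    using assms by (auto intro!: inj_onI)
  have im: "?s ` (L - {0}) = scaled \<alpha> L - {0}"
    using assms by (auto simp: scaled_def)
  have "(\<Prod>w\<in>?s ` F. 1 - z / w) = (\<Prod>w\<in>F. 1 - \<alpha> * z / w)" for F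
    using assms by (subst prod.reindex[OF inj]) (auto intro!: prod.cong simp: field_simps)
  then have "Lim (finite_subsets_at_top (scaled \<alpha> L - {0})) (\<lambda>F. \<Prod>w\<in>F. 1 - z / w)
      = Lim (finite_subsets_at_top (L - {0})) (\<lambda>F. \<Prod>w\<in>F. 1 - \<alpha> * z / w)"
    unfolding im[symmetric] filtermap_image_finite_subsets_at_top[OF inj, symmetric] t2_space_class.Lim_def
    by (simp add: filterlim_filtermap)
  then show ?thesis
    by (simp add: exp_lattice_def)
qed

section \<open>Infinite products over discrete sets\<close>

text \<open>The sort of \<open>'c\<close> provides a complete metric unrelated to the field
  operations; these axioms tie the two together, without reference to an embedding.\<close>

locale ultrametric_field =
  fixes F :: "'c::{field,complete_space} itself"
  assumes dist_eq_cabs: "dist v w = cabs (v - w :: 'c)"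
    and cabs_mult: "cabs (v * w :: 'c) = cabs v * cabs w"
    and cabs_ultrametric: "cabs (v + w :: 'c) \<le> max (cabs v) (cabs w)"
begin

lemma cabs_nonneg [simp]: "0 \<le> cabs (v :: 'c)"
  and cabs_eq_0_iff [simp]: "cabs (v :: 'c) = 0 \<longleftrightarrow> v = 0"
  by (simp_all add: cabs_def)

lemma cabs_zero [simp]: "cabs (0 :: 'c) = 0"
  by simp

lemma cabs_pos_iff [simp]: "0 < cabs (v :: 'c) \<longleftrightarrow> v \<noteq> 0"
  by (simp add: cabs_def)

lemma cabs_one [simp]: "cabs (1 :: 'c) = 1"
  using cabs_mult[of 1 1] cabs_eq_0_iff[of 1] by simp

lemma cabs_minus [simp]: "cabs (- v :: 'c) = cabs v"
  using dist_eq_cabs[of 0 v] by (simp add: cabs_def dist_commute)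

lemma cabs_minus_commute: "cabs (v - w :: 'c) = cabs (w - v)"
  using cabs_minus[of "v - w"] by simp

lemma cabs_ultrametric_diff: "cabs (v - w :: 'c) \<le> max (cabs v) (cabs w)"
  using cabs_ultrametric[of v "- w"] by simp

lemma cabs_divide: "cabs (v / w :: 'c) = cabs v / cabs w"
proof (cases "w = 0")
  case False
  then show ?thesis using cabs_mult[of "v / w" w] by (simp add: field_simps)
qed simp

lemma cabs_eq_1:
  assumes "cabs (u - 1 :: 'c) < 1"
  shows "cabs u = 1"
  using cabs_ultrametric[of "u - 1" 1] cabs_ultrametric_diff[of "u" "u - 1"] assms by auto

text \<open>The induction splits the difference into \<open>(g w - 1) * P\<close> and
  \<open>P - 1\<close> for the partial product \<open>P\<close>, whose absolute value is 1 because
  \<open>e \<le> 1\<close>; hence no error accumulates.\<close>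

lemma cabs_prod_minus_1:
  assumes "e \<le> 1" "0 < e" "\<And>w. w \<in> A \<Longrightarrow> cabs (g w - 1 :: 'c) < e"
  shows "cabs (prod g A - 1) < e"
  using assms(3)
proof (induction A rule: infinite_finite_induct)
  case (insert w A)
  have "cabs (prod g (insert w A) - 1) = cabs ((g w - 1) * prod g A + (prod g A - 1))"
    using insert by (simp add: algebra_simps)
  also have "\<dots> \<le> max (cabs (g w - 1) * cabs (prod g A)) (cabs (prod g A - 1))"
    using cabs_ultrametric cabs_mult by metis
  also have "\<dots> < e"
    using insert cabs_eq_1[of "prod g A"] assms(1) by simp
  finally show ?case .
qed (use assms in \<open>auto simp: cabs_def\<close>)

text \<open>Only finitely many factors are at distance \<open>e\<close> or more from 1; the others
  change a finite product by a factor within \<open>e\<close> of 1. This gives the Cauchy condition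
  and makes the absolute values eventually constant, so the limit is not 0.\<close>

lemma product_converges:
  fixes g :: "'i \<Rightarrow> 'c"
  assumes fin: "\<And>e. 0 < e \<Longrightarrow> finite {w \<in> I. e \<le> cabs (g w - 1)}"
    and nz: "\<And>w. w \<in> I \<Longrightarrow> g w \<noteq> 0"
  obtains P where "P \<noteq> 0" "((\<lambda>A. prod g A) \<longlongrightarrow> P) (finite_subsets_at_top I)"
proof -
  define B where "B e = {w \<in> I. e \<le> cabs (g w - 1)}" for e
  have finB: "finite (B e)" if "0 < e" for e
    using fin[OF that] by (simp add: B_def)
  have tail: "cabs (prod g (A - B e) - 1) < e" if "A \<subseteq> I" "0 < e" "e \<le> 1" for A e
    by (rule cabs_prod_minus_1) (use that in \<open>auto simp: B_def not_le[symmetric]\<close>)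
  have split: "prod g A = prod g (B e) * prod g (A - B e)" if "finite A" "B e \<subseteq> A" for A e
    using prod.subset_diff[OF that(2,1), of g] by (simp add: mult.commute)
  have BB: "B 1 \<subseteq> B e" if "e \<le> 1" for e
    using that by (auto simp: B_def)
  \<comment> \<open>\<open>K\<close> is the common absolute value of all finite products that
    contain the factors from \<open>B 1\<close>; it converts multiplicative into additive
    closeness.\<close>
  define K where "K = cabs (prod g (B 1))"
  have K: "cabs (prod g A) = K" if "finite A" "A \<subseteq> I" "B 1 \<subseteq> A" for A
    using split[OF that(1,3)] cabs_eq_1[OF tail[OF that(2), of 1]] by (simp add: K_def cabs_mult)
  have Kpos: "K > 0"
    unfolding K_def using nz finB[of 1] by (auto simp: B_def)
  have close: "dist (prod g A) (prod g (B e)) < K * e"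
    if "finite A" "A \<subseteq> I" "B e \<subseteq> A" "0 < e" "e \<le> 1" for A e
  proof -
    have "prod g A - prod g (B e) = prod g (B e) * (prod g (A - B e) - 1)"
      unfolding split[OF that(1,3)] by (simp add: algebra_simps)
    then have "dist (prod g A) (prod g (B e)) = K * cabs (prod g (A - B e) - 1)"
      using K[OF finB[OF that(4)] _ BB[OF that(5)]] by (simp add: dist_eq_cabs cabs_mult B_def)
    also have "\<dots> < K * e"
      using tail[OF that(2,4,5)] Kpos by simp
    finally show ?thesis .
  qed
  \<comment> \<open>Completeness concerns sequences, so the limit is first found along a sequence of
    products; \<open>close_s\<close> then compares the whole net with it.\<close>
  define s where "s n = prod g (B (inverse (real (Suc n))))" for n
  have close_s: "dist (prod g A) (s n) < K * inverse (real (Suc n))"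
    if "finite A" "A \<subseteq> I" "B (inverse (real (Suc n))) \<subseteq> A" for A n
    unfolding s_def using that by (intro close) (auto simp: field_simps)
  have small: "\<forall>\<^sub>F n in sequentially. K * inverse (real (Suc n)) < e" if "0 < e" for e
  proof -
    have "(\<lambda>n. K * inverse (real (Suc n))) \<longlonglongrightarrow> K * 0"
      by (intro tendsto_mult tendsto_const LIMSEQ_inverse_real_of_nat)
    then show ?thesis using order_tendstoD(2) that by fastforce
  qed
  have "Cauchy s"
    unfolding Cauchy_altdef2
  proof (intro allI impI)
    fix e :: real assume "0 < e"
    then obtain N where N: "K * inverse (real (Suc N)) < e"
      using small eventually_happens'[OF sequentially_bot] by blast
    have "dist (s n) (s N) < e" if "n \<ge> N" for n
    proof -
      have le: "inverse (real (Suc n)) \<le> inverse (real (Suc N))"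
        using that by (simp add: field_simps)
      have "dist (s n) (s N) < K * inverse (real (Suc N))"
        unfolding s_def[of n] by (intro close_s finB) (use order_trans[OF le] in \<open>auto simp: B_def simp del: of_nat_Suc\<close>)
      with N show ?thesis by simp
    qed
    then show "\<exists>N. \<forall>n\<ge>N. dist (s n) (s N) < e" by blast
  qed
  then obtain P where P: "s \<longlonglongrightarrow> P"
    using Cauchy_convergent_iff convergent_def by blast
  have "((\<lambda>A. prod g A) \<longlongrightarrow> P) (finite_subsets_at_top I)"
  proof (rule tendstoI)
    fix e :: real assume e: "0 < e"
    have "\<forall>\<^sub>F n in sequentially. dist (s n) P < e / 2 \<and> K * inverse (real (Suc n)) < e / 2"
      by (intro eventually_conj tendstoD[OF P] small) (use e in simp_all)
    then obtain n where n: "dist (s n) P < e / 2" "K * inverse (real (Suc n)) < e / 2"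
      using eventually_happens'[OF sequentially_bot] by blast
    have "dist (prod g A) P < e" if "finite A" "A \<subseteq> I" "B (inverse (real (Suc n))) \<subseteq> A" for A
      using dist_triangle[of "prod g A" P "s n"] close_s[OF that] n by linarith
    then show "\<forall>\<^sub>F A in finite_subsets_at_top I. dist (prod g A) P < e"
      unfolding eventually_finite_subsets_at_top
    proof (intro exI conjI allI impI)
      show "finite (B (inverse (real (Suc n))))" by (rule finB) simp
      show "B (inverse (real (Suc n))) \<subseteq> I" unfolding B_def by blast
    qed blast
  qed
  moreover have "P \<noteq> 0"
  proof
    assume "P = 0"
    then have "\<forall>\<^sub>F n in sequentially. dist (s n) 0 < K"
      using tendstoD[OF P] Kpos by simp
    then obtain n where "dist (s n) 0 < K"
      using eventually_happens'[OF sequentially_bot] by blast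
    moreover have "cabs (s n) = K"
      unfolding s_def by (intro K finB BB) (auto simp: B_def field_simps)
    ultimately show False by (simp add: cabs_def)
  qed
  ultimately show ?thesis using that by blast
qed

text \<open>Finiteness in every ball is the sense of discreteness used for lattices; without local
  compactness it is stronger than topological discreteness.\<close>

definition discrete :: "'c set \<Rightarrow> bool" where
  "discrete L \<longleftrightarrow> (\<forall>r. finite {w \<in> L. cabs w \<le> r})"

lemma discrete_finite: "discrete L \<Longrightarrow> finite {w \<in> L. cabs w \<le> r}"
  by (simp add: discrete_def)

lemma discrete_subset: "discrete M \<Longrightarrow> L \<subseteq> M \<Longrightarrow> discrete L"
  unfolding discrete_def by (blast intro: finite_subset[rotated])

text \<open>If \<open>z\<close> is a nonzero element of \<open>L\<close>, one factor vanishes and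
  with it all large finite products. Otherwise no factor vanishes, and \<open>1 - z / w\<close> is
  at distance \<open>e\<close> or more from 1 only if
  \<open>cabs w \<le> cabs z / e\<close>.\<close>

lemma exp_product_converges:
  assumes L: "discrete L"
  obtains P where "((\<lambda>F. \<Prod>w\<in>F. 1 - z / w) \<longlongrightarrow> P) (finite_subsets_at_top (L - {0}))"
    and "z \<notin> L \<Longrightarrow> P \<noteq> 0"
proof -
  have conv: "\<exists>P. P \<noteq> 0 \<and> ((\<lambda>F. \<Prod>w\<in>F. 1 - z / w) \<longlongrightarrow> P) (finite_subsets_at_top (L - {0}))"
    if z: "z \<notin> L - {0}"
  proof -
    have fin: "finite {w \<in> L - {0}. e \<le> cabs ((1 - z / w) - 1)}" if "0 < e" for e
    proof (rule finite_subset)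
      show "finite {w \<in> L. cabs w \<le> cabs z / e}"
        by (rule discrete_finite[OF L])
      show "{w \<in> L - {0}. e \<le> cabs ((1 - z / w) - 1)} \<subseteq> {w \<in> L. cabs w \<le> cabs z / e}"
        using that by (auto simp: cabs_divide field_simps)
    qed
    have nz: "1 - z / w \<noteq> 0" if "w \<in> L - {0}" for w
      using that z by (auto simp: field_simps)
    show ?thesis
      by (rule product_converges[OF fin nz]) blast+
  qed
  show ?thesis
  proof (cases "z \<in> L - {0}")
    case True
    have "((\<lambda>F. \<Prod>w\<in>F. 1 - z / w) \<longlongrightarrow> 0) (finite_subsets_at_top (L - {0}))"
    proof (rule tendsto_eventually)
      show "\<forall>\<^sub>F F in finite_subsets_at_top (L - {0}). (\<Prod>w\<in>F. 1 - z / w) = 0"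
        unfolding eventually_finite_subsets_at_top
      proof (intro exI[of _ "{z}"] conjI allI impI)
        fix F assume "finite F \<and> {z} \<subseteq> F \<and> F \<subseteq> L - {0}"
        then show "(\<Prod>w\<in>F. 1 - z / w) = 0"
          by (intro prod_zero bexI[of _ z]) auto
      qed (use True in auto)
    qed
    with that True show ?thesis by blast
  next
    case False
    with conv that show ?thesis by blast
  qed
qed

lemma exp_lattice_nonzero:
  assumes "discrete L" "0 \<in> L" "z \<notin> L"
  shows "exp_lattice L z \<noteq> 0"
proof -
  obtain P where P: "((\<lambda>F. \<Prod>w\<in>F. 1 - z / w) \<longlongrightarrow> P) (finite_subsets_at_top (L - {0}))" "P \<noteq> 0"
    using exp_product_converges assms by metis
  then have "exp_lattice L z = z * P"
    by (simp add: exp_lattice_def tendsto_Lim)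
  with assms P show ?thesis by auto
qed

section \<open>Continuity of the field operations\<close>

lemma tendsto_mult_cabs:
  fixes x y :: 'c
  assumes "(f \<longlongrightarrow> x) G" "(g \<longlongrightarrow> y) G"
  shows "((\<lambda>t. f t * g t) \<longlongrightarrow> x * y) G"
proof (rule tendstoI)
  fix e :: real assume e: "0 < e"
  \<comment> \<open>\<open>K\<close> bounds both limits and, by the ultrametric inequality, also
    \<open>g t\<close> once it is within 1 of \<open>y\<close>; this is why \<open>h\<close> is kept
    at most 1.\<close>
  define K where "K = max (cabs x) (cabs y) + 1"
  have K: "K \<ge> 1" "K > 0" "cabs x < K" "cabs y < K"
    using cabs_nonneg[of x] unfolding K_def by linarith+
  define h where "h = min 1 (e / K)"
  have h: "h > 0" "h \<le> 1" "K * h \<le> e"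
    using e K by (auto simp: h_def min_def field_simps)
  have "\<forall>\<^sub>F t in G. dist (f t) x < h \<and> dist (g t) y < h"
    using assms h by (intro eventually_conj) (auto dest: tendstoD)
  then show "\<forall>\<^sub>F t in G. dist (f t * g t) (x * y) < e"
  proof eventually_elim
    case (elim t)
    have gt: "cabs (g t) < K"
      using cabs_ultrametric[of "g t - y" y] elim h K by (auto simp: dist_eq_cabs max_def split: if_splits)
    have "dist (f t * g t) (x * y) = cabs ((f t - x) * g t + x * (g t - y))"
      by (simp add: dist_eq_cabs algebra_simps)
    also have "\<dots> \<le> max (cabs (f t - x) * cabs (g t)) (cabs x * cabs (g t - y))"
      using cabs_ultrametric cabs_mult by metis
    also have "\<dots> < K * h"
    proof -
      have "cabs (f t - x) * cabs (g t) < h * K" "cabs x * cabs (g t - y) < K * h"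
        using elim gt K h by (auto intro!: mult_strict_mono' simp: dist_eq_cabs)
      then show ?thesis by (simp add: mult.commute)
    qed
    finally show ?case using h by simp
  qed
qed

lemma tendsto_diff_cabs:
  fixes x y :: 'c
  assumes "(f \<longlongrightarrow> x) G" "(g \<longlongrightarrow> y) G"
  shows "((\<lambda>t. f t - g t) \<longlongrightarrow> x - y) G"
proof (rule tendstoI)
  fix e :: real assume "0 < e"
  then have "\<forall>\<^sub>F t in G. dist (f t) x < e \<and> dist (g t) y < e"
    using assms by (intro eventually_conj) (auto dest: tendstoD)
  then show "\<forall>\<^sub>F t in G. dist (f t - g t) (x - y) < e"
  proof eventually_elim
    case (elim t)
    then show ?case
      using cabs_ultrametric_diff[of "f t - x" "g t - y"] unfolding dist_eq_cabs
      by (simp add: algebra_simps max_def split: if_splits)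
  qed
qed

lemma tendsto_inverse_cabs:
  fixes x :: 'c
  assumes f: "(f \<longlongrightarrow> x) G" and x: "x \<noteq> 0"
  shows "((\<lambda>t. inverse (f t)) \<longlongrightarrow> inverse x) G"
proof (rule tendstoI)
  fix e :: real assume e: "0 < e"
  \<comment> \<open>The first bound forces \<open>cabs (f t) \<ge> cabs x\<close>, which keeps the
    denominator away from 0; the second makes the quotient less than \<open>e\<close>.\<close>
  define h where "h = min (cabs x) (e * cabs x * cabs x)"
  have h: "0 < h" using e x by (simp add: h_def)
  have "\<forall>\<^sub>F t in G. dist (f t) x < h"
    by (rule tendstoD[OF f h])
  then show "\<forall>\<^sub>F t in G. dist (inverse (f t)) (inverse x) < e"
  proof eventually_elim
    case (elim t)
    have ge: "cabs (f t) \<ge> cabs x"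
      using cabs_ultrametric_diff[of "f t" "f t - x"] elim by (auto simp: dist_eq_cabs h_def)
    then have nz: "f t \<noteq> 0" using x cabs_pos_iff[of x] by (metis cabs_zero not_le)
    have "inverse (f t) - inverse x = (x - f t) / (f t * x)"
      using nz x by (simp add: field_simps)
    then have "dist (inverse (f t)) (inverse x) = cabs (x - f t) / (cabs (f t) * cabs x)"
      by (simp add: dist_eq_cabs cabs_divide cabs_mult)
    also have "\<dots> \<le> cabs (x - f t) / (cabs x * cabs x)"
      using ge x nz by (intro divide_left_mono mult_right_mono) auto
    also have "\<dots> < e"
      using elim x by (simp add: dist_eq_cabs h_def cabs_minus_commute field_simps)
    finally show ?case .
  qed
qed

lemma tendsto_prod_cabs:
  fixes x :: "'i \<Rightarrow> 'c"
  assumes "\<And>i. i \<in> I \<Longrightarrow> (f i \<longlongrightarrow> x i) G"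
  shows "((\<lambda>t. \<Prod>i\<in>I. f i t) \<longlongrightarrow> (\<Prod>i\<in>I. x i)) G"
  using assms
  by (induction I rule: infinite_finite_induct) (auto intro!: tendsto_mult_cabs)

text \<open>Every finite subset of \<open>L - {0}\<close> lies in some ball, so the balls, finite
  themselves, are cofinal in the net defining the exponential.\<close>

lemma exp_lattice_ball_tendsto:
  assumes L: "discrete L"
  shows "(\<lambda>n. exp_lattice {w \<in> L. cabs w \<le> real n} z) \<longlonglongrightarrow> exp_lattice L z"
proof -
  let ?V = "\<lambda>n. {w \<in> L. cabs w \<le> real n}"
  obtain P where P: "((\<lambda>F. \<Prod>w\<in>F. 1 - z / w) \<longlongrightarrow> P) (finite_subsets_at_top (L - {0}))"
    using exp_product_converges[OF L] by metis
  have "filterlim (\<lambda>n. ?V n - {0}) (finite_subsets_at_top (L - {0})) sequentially"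
    unfolding filterlim_finite_subsets_at_top
  proof (intro allI impI)
    fix A assume A: "finite A \<and> A \<subseteq> L - {0}"
    then obtain r where r: "\<And>w. w \<in> A \<Longrightarrow> cabs w \<le> r"
      by (metis (no_types, lifting) Max_ge finite_imageI imageI)
    have "A \<subseteq> ?V n - {0}" if "n \<ge> nat \<lceil>r\<rceil>" for n
    proof -
      have "r \<le> real n" using that by linarith
      with r A show ?thesis by (auto intro: order_trans)
    qed
    then show "\<forall>\<^sub>F n in sequentially. finite (?V n - {0}) \<and> A \<subseteq> ?V n - {0} \<and> ?V n - {0} \<subseteq> L - {0}"
      using discrete_finite[OF L] unfolding eventually_sequentially
      by (intro exI[of _ "nat \<lceil>r\<rceil>"]) auto
  qed
  from filterlim_compose[OF P this]
  have "(\<lambda>n. z * (\<Prod>w\<in>?V n - {0}. 1 - z / w)) \<longlonglongrightarrow> z * P"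
    by (intro tendsto_mult_cabs) auto
  moreover have "exp_lattice L z = z * P"
    using P by (simp add: exp_lattice_def tendsto_Lim)
  ultimately show ?thesis
    using discrete_finite[OF L] by (simp add: exp_lattice_finite)
qed

lemma add_subgroup_ball:
  assumes "add_subgroup (L :: 'c set)" "0 \<le> r"
  shows "add_subgroup {w \<in> L. cabs w \<le> r}"
  using assms by (auto simp: add_subgroup_def intro!: order_trans[OF cabs_ultrametric_diff])

text \<open>The finite identity is applied to the balls of radius \<open>n\<close> and passed to the
  limit. The denominators have nonzero limits since no representative lies in
  \<open>L\<close>.\<close>

lemma exp_lattice_quotient:
  assumes M: "add_subgroup M" "discrete M" and L: "L \<subseteq> M" "add_subgroup L"
    and R: "nonzero_class_reps M L R" "finite R"
  shows "exp_lattice M z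
    = exp_lattice L z * (\<Prod>w\<in>R. 1 - exp_lattice L z / exp_lattice L w)"
proof -
  have dL: "discrete L" using M L discrete_subset by blast
  let ?V = "\<lambda>n. {w \<in> L. cabs w \<le> real n}" and ?W = "\<lambda>n. {w \<in> M. cabs w \<le> real n}"
  have RM: "R \<subseteq> M - L"
    using R by (auto simp: nonzero_class_reps_def)
  have uniq: "\<exists>!r. r \<in> R \<and> (r, x) \<in> coset_rel M L" if "x \<in> M - L" for x
    using R that by (auto simp: nonzero_class_reps_def)
  have tends: "(\<lambda>n. exp_lattice (?V n) y) \<longlonglongrightarrow> exp_lattice L y" for y
    by (rule exp_lattice_ball_tendsto[OF dL])
  have "(\<lambda>n. exp_lattice (?V n) z *
      (\<Prod>w\<in>R. 1 - exp_lattice (?V n) z * inverse (exp_lattice (?V n) w)))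
    \<longlonglongrightarrow> exp_lattice L z * (\<Prod>w\<in>R. 1 - exp_lattice L z * inverse (exp_lattice L w))"
    using RM L(2)
    by (intro tendsto_mult_cabs tendsto_prod_cabs tendsto_diff_cabs tendsto_inverse_cabs tends
        tendsto_const exp_lattice_nonzero[OF dL]) (auto intro: add_subgroup_zero)
  moreover have "\<forall>\<^sub>F n in sequentially. exp_lattice (?V n) z *
      (\<Prod>w\<in>R. 1 - exp_lattice (?V n) z * inverse (exp_lattice (?V n) w)) = exp_lattice (?W n) z"
  proof -
    obtain r where r: "\<And>w. w \<in> R \<Longrightarrow> cabs w \<le> r"
      using R(2) by (metis (no_types, lifting) Max_ge finite_imageI imageI)
    have "exp_lattice (?W n) z = exp_lattice (?V n) z *
      (\<Prod>w\<in>R. 1 - exp_lattice (?V n) z / exp_lattice (?V n) w)" if n: "n \<ge> nat \<lceil>r\<rceil>" for n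
    proof (rule exp_lattice_quotient_finite)
      have rn: "cabs w \<le> real n" if "w \<in> R" for w
        using r[OF that] n by linarith
      \<comment> \<open>The ball now contains \<open>R\<close> and is closed under differences, so
        its coset relation is the restriction of the given one.\<close>
      show "nonzero_class_reps (?W n) (?V n) R"
        unfolding nonzero_class_reps_def
      proof (intro conjI ballI)
        show "R \<subseteq> ?W n - ?V n" using RM rn by auto
        fix x assume x: "x \<in> ?W n - ?V n"
        then have "x \<in> M - L" by auto
        moreover have "r \<in> R \<and> (r, x) \<in> coset_rel (?W n) (?V n) \<longleftrightarrow> r \<in> R \<and> (r, x) \<in> coset_rel M L" for r
          using x RM rn[of r] order_trans[OF cabs_ultrametric_diff[of r x]] by (auto simp: coset_rel_def)
        ultimately show "\<exists>!r. r \<in> R \<and> (r, x) \<in> coset_rel (?W n) (?V n)"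
          using uniq by simp
      qed
    qed (use M L discrete_finite add_subgroup_ball in auto)
    then show ?thesis
      unfolding eventually_sequentially by (intro exI[of _ "nat \<lceil>r\<rceil>"]) (simp add: divide_inverse)
  qed
  ultimately have "(\<lambda>n. exp_lattice (?W n) z) \<longlonglongrightarrow>
      exp_lattice L z * (\<Prod>w\<in>R. 1 - exp_lattice L z * inverse (exp_lattice L w))"
    by (rule Lim_transform_eventually)
  from LIMSEQ_unique[OF exp_lattice_ball_tendsto[OF M(2)] this] show ?thesis
    by (simp add: divide_inverse)
qed

end

section \<open>Finite fields\<close>

lemma two_le_CARD_field: "2 \<le> CARD('a::{field,finite})"
proof -
  have "card {0, 1 :: 'a} \<le> CARD('a)"
    by (intro card_mono) auto
  then show ?thesis by simp
qed

text \<open>Translation by 1 permutes the field, so adding 1 to every element leaves the sum of all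
  elements unchanged.\<close>

lemma of_nat_CARD_field: "of_nat CARD('a::{field,finite}) = (0 :: 'a)"
proof -
  have "(\<Sum>x::'a\<in>UNIV. x) = (\<Sum>x\<in>UNIV. x + 1)"
    by (rule sum.reindex_bij_witness[where i = "\<lambda>x. x + 1" and j = "\<lambda>x. x - 1"]) auto
  then show ?thesis
    by (simp add: sum.distrib)
qed

text \<open>Multiplication by \<open>c\<close> permutes the nonzero elements; their product is
  compared before and after.\<close>

lemma power_CARD_minus_1:
  fixes c :: "'a::{field,finite}"
  assumes "c \<noteq> 0"
  shows "c ^ (CARD('a) - 1) = 1"
proof -
  have "(\<Prod>x\<in>UNIV - {0::'a}. x) = (\<Prod>x\<in>UNIV - {0}. c * x)"
    by (rule prod.reindex_bij_witness[where i = "\<lambda>x. c * x" and j = "\<lambda>x. x / c"])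
      (use assms in auto)
  also have "\<dots> = c ^ (CARD('a) - 1) * (\<Prod>x\<in>UNIV - {0}. x)"
    by (simp add: prod.distrib card_Diff_singleton)
  finally show ?thesis by simp
qed

lemma power_CARD_power:
  fixes c :: "'a::{field,finite}"
  shows "c ^ (CARD('a) ^ k) = c"
proof -
  have "c ^ CARD('a) = c"
  proof (cases "c = 0")
    case False
    have "c ^ CARD('a) = c * c ^ (CARD('a) - 1)"
      using two_le_CARD_field[where 'a = 'a] by (subst power_Suc[symmetric]) simp
    with power_CARD_minus_1[OF False] show ?thesis by simp
  qed simp
  then show ?thesis
    by (induction k) (simp_all add: power_mult mult.commute)
qed

section \<open>The filtration of Laurent series by order\<close>

text \<open>Over a field this is the fractional ideal generated by the \<open>m\<close>-th power of
  \<open>1/T\<close>. It is described by coefficients because \<open>fls_subdegree\<close> is 0 at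
  the zero series.\<close>

definition fls_ideal :: "int \<Rightarrow> 'b::zero fls set" where
  "fls_ideal m = {x. \<forall>n<m. fls_nth x n = 0}"

lemma fls_ideal_iff: "x \<in> fls_ideal m \<longleftrightarrow> x = 0 \<or> m \<le> fls_subdegree x"
  unfolding fls_ideal_def
  by (auto intro: fls_subdegree_geI)

lemma fls_ideal_zero [simp]: "0 \<in> fls_ideal m"
  by (simp add: fls_ideal_def)

lemma fls_ideal_diff:
  fixes x y :: "'b::ab_group_add fls"
  shows "x \<in> fls_ideal m \<Longrightarrow> y \<in> fls_ideal m \<Longrightarrow> x - y \<in> fls_ideal m"
  by (simp add: fls_ideal_def)

lemma fls_ideal_add:
  fixes x y :: "'b::ab_group_add fls"
  shows "x \<in> fls_ideal m \<Longrightarrow> y \<in> fls_ideal m \<Longrightarrow> x + y \<in> fls_ideal m"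
  by (simp add: fls_ideal_def)

lemma fls_ideal_sum:
  fixes x :: "'i \<Rightarrow> 'b::ab_group_add fls"
  shows "(\<And>i. i \<in> A \<Longrightarrow> x i \<in> fls_ideal m) \<Longrightarrow> sum x A \<in> fls_ideal m"
  by (induction A rule: infinite_finite_induct) (auto intro: fls_ideal_add)

lemma fls_ideal_antimono: "m \<le> n \<Longrightarrow> fls_ideal n \<subseteq> fls_ideal m"
  by (auto simp: fls_ideal_def)

lemma fls_ideal_mult:
  fixes x y :: "'b::idom fls"
  shows "x \<in> fls_ideal m \<Longrightarrow> y \<in> fls_ideal n \<Longrightarrow> x * y \<in> fls_ideal (m + n)"
  unfolding fls_ideal_iff by (cases "x = 0"; cases "y = 0") auto

text \<open>For \<open>m \<ge> 1\<close> these are the higher unit groups; for \<open>m = 0\<close>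
  the condition only says that \<open>x\<close> is integral.\<close>

definition one_units :: "int \<Rightarrow> 'b::{zero,one,minus,group_add} fls set" where
  "one_units m = {x. x - 1 \<in> fls_ideal m}"

lemma one_units_one [simp]: "1 \<in> one_units m"
  by (simp add: one_units_def)

lemma one_units_antimono: "m \<le> n \<Longrightarrow> one_units n \<subseteq> one_units m"
  using fls_ideal_antimono by (auto simp: one_units_def)

lemma one_units_in_ideal_0:
  fixes x :: "'b::idom fls"
  assumes "x \<in> one_units m" "0 \<le> m"
  shows "x \<in> fls_ideal 0"
proof -
  have "x - 1 \<in> fls_ideal 0"
    using assms fls_ideal_antimono by (auto simp: one_units_def)
  moreover have "1 \<in> fls_ideal 0"
    by (simp add: fls_ideal_iff)
  ultimately show ?thesis
    using fls_ideal_add by fastforce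
qed

lemma one_units_subdegree:
  fixes x :: "'b::idom fls"
  assumes "x \<in> one_units 1"
  shows "fls_subdegree x = 0" "x \<noteq> 0"
proof -
  have "fls_nth (x - 1) n = 0" if "n < 1" for n
    using assms that by (simp add: one_units_def fls_ideal_def)
  then have "fls_nth x n = fls_nth 1 n" if "n \<le> 0" for n
    using that by (metis eq_iff_diff_eq_0 fls_minus_nth int_one_le_iff_zero_less linorder_not_le)
  then have "fls_nth x n = (if n = 0 then 1 else 0)" if "n \<le> 0" for n
    using that by simp
  from this[of 0] this have "fls_nth x 0 = 1" "\<And>n. n < 0 \<Longrightarrow> fls_nth x n = 0"
    by auto
  then show "fls_subdegree x = 0" "x \<noteq> 0"
    by (auto intro!: fls_subdegree_eqI)
qed

lemma one_units_mult:
  fixes x y :: "'b::idom fls"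
  assumes "x \<in> one_units m" "y \<in> one_units m" "0 \<le> m"
  shows "x * y \<in> one_units m"
proof -
  have "x * y - 1 = (x - 1) * y + (y - 1)"
    by (simp add: algebra_simps)
  moreover have "(x - 1) * y \<in> fls_ideal (m + 0)"
    using assms one_units_in_ideal_0[of y m] by (intro fls_ideal_mult) (auto simp: one_units_def)
  ultimately show ?thesis
    using assms by (simp only: one_units_def mem_Collect_eq) (auto intro: fls_ideal_add)
qed

lemma one_units_prod:
  fixes x :: "'i \<Rightarrow> 'b::idom fls"
  shows "(\<And>i. i \<in> A \<Longrightarrow> x i \<in> one_units m) \<Longrightarrow> 0 \<le> m \<Longrightarrow> prod x A \<in> one_units m"
  by (induction A rule: infinite_finite_induct) (auto intro: one_units_mult)

lemma one_units_power:
  fixes x :: "'b::idom fls"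
  shows "x \<in> one_units m \<Longrightarrow> 0 \<le> m \<Longrightarrow> x ^ n \<in> one_units m"
  by (induction n) (auto intro: one_units_mult)

text \<open>\<open>u\<^sup>q - 1\<close> is \<open>u - 1\<close> times \<open>\<Sum>i<q. u\<^sup>i\<close>, and the latter is congruent to \<open>q = 0\<close>.\<close>
lemma one_units_power_CARD:
  fixes u :: "'a::{field,finite} fls"
  assumes u: "u \<in> one_units m" and m: "1 \<le> m"
  shows "u ^ CARD('a) \<in> one_units (m + 1)"
proof -
  have "of_nat CARD('a) = (0 :: 'a fls)"
    by (simp only: fls_of_nat of_nat_CARD_field fls_const_0)
  then have "(\<Sum>i<CARD('a). u ^ i) = (\<Sum>i<CARD('a). u ^ i - 1)"
    by (simp add: sum_subtractf)
  also have "\<dots> \<in> fls_ideal m"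
    using one_units_power[OF u] m by (intro fls_ideal_sum) (auto simp: one_units_def)
  finally have "(u - 1) * (\<Sum>i<CARD('a). u ^ i) \<in> fls_ideal (m + m)"
    using u by (intro fls_ideal_mult) (auto simp: one_units_def)
  then show ?thesis
    using fls_ideal_antimono[of "m + 1" "m + m"] m
    by (auto simp: one_units_def power_diff_1_eq)
qed

lemma one_units_power_CARD_power:
  fixes u :: "'a::{field,finite} fls"
  assumes u: "u \<in> one_units 1"
  shows "u ^ (CARD('a) ^ k) \<in> one_units (int k + 1)"
proof (induction k)
  case (Suc k)
  then show ?case
    using one_units_power_CARD[OF Suc.IH] by (simp add: power_mult[symmetric] mult.commute add.commute)
qed (use u in simp)

text \<open>Division by the leading coefficient \<open>c\<close> leaves a one-unit, and
  \<open>c\<close> itself disappears in the power.\<close>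

lemma power_CARD_minus_1_one_unit:
  fixes x :: "'a::{field,finite} fls"
  assumes x: "x \<noteq> 0" "fls_subdegree x = 0"
  shows "x ^ (CARD('a) - 1) \<in> one_units 1"
proof -
  define c where "c = fls_nth x 0"
  have c: "c \<noteq> 0"
    using x nth_fls_subdegree_nonzero[of x] by (simp add: c_def)
  define z where "z = x * fls_const (inverse c)"
  have "fls_nth (z - 1) n = 0" if "n < 1" for n
    using that x(2) c by (cases "n = 0") (auto simp: z_def c_def)
  then have z: "z \<in> one_units 1"
    by (simp add: one_units_def fls_ideal_def)
  have "z ^ (CARD('a) - 1) = x ^ (CARD('a) - 1) * fls_const (inverse c ^ (CARD('a) - 1))"
    by (simp add: z_def power_mult_distrib fls_const_power)
  also have "inverse c ^ (CARD('a) - 1) = 1"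
    using c by (intro power_CARD_minus_1) simp
  finally show ?thesis
    using one_units_power[OF z] by (metis fls_const_1 mult.right_neutral zero_le_one)
qed

text \<open>Translates estimates in the filtration into the base 2 metric in which the period limits
  are taken.\<close>

lemma fls_tendsto:
  fixes u :: "nat \<Rightarrow> 'b::ab_group_add fls"
  assumes "\<And>m. \<forall>\<^sub>F n in sequentially. u n - L \<in> fls_ideal m"
  shows "u \<longlonglongrightarrow> L"
proof (rule tendstoI)
  fix e :: real assume "0 < e"
  then obtain m where m: "inverse (2 ^ m) < e"
    using reals_power_lt_ex[of e 2] by (auto simp: inverse_eq_divide power_one_over)
  have "\<forall>\<^sub>F n in sequentially. u n - L \<in> fls_ideal (int m)"
    by (rule assms)
  then show "\<forall>\<^sub>F n in sequentially. dist (u n) L < e"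
  proof eventually_elim
    case (elim n)
    show ?case
    proof (cases "u n = L")
      case False
      with elim have le: "int m \<le> fls_subdegree (u n - L)"
        by (simp add: fls_ideal_iff)
      then have "inverse (2 ^ nat (fls_subdegree (u n - L))) \<le> inverse (2 ^ m :: real)"
        by (intro le_imp_inverse_le power_increasing) auto
      with m le False show ?thesis
        by (simp add: dist_fls_def order.strict_trans1[OF _ m])
    qed (use \<open>0 < e\<close> in simp)
  qed
qed

text \<open>Factors that are one-units of level 1 preserve the order \<open>s\<close>, and those of
  level \<open>m\<close> change only coefficients from index \<open>s + m\<close> on. The limit is
  assembled from the stable coefficients and keeps a nonzero one at \<open>s\<close>.\<close>

lemma fls_product_converges:
  fixes u :: "nat \<Rightarrow> 'b::idom fls"
  assumes nz: "\<And>n. u n \<noteq> 0"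
    and step: "\<And>m::nat. \<exists>N. \<forall>n\<ge>N. \<exists>e\<in>one_units (int m). u (Suc n) = u n * e"
  obtains L where "L \<noteq> 0" "u \<longlonglongrightarrow> L"
proof -
  obtain N where N: "\<exists>e\<in>one_units (int m). u (Suc n) = u n * e" if "n \<ge> N m" for m n
    using step by metis
  define s where "s = fls_subdegree (u (N 1))"
  have sub: "fls_subdegree (u n) = s" if "n \<ge> N 1" for n
    using that
  proof (induction n rule: dec_induct)
    case (step n)
    then obtain e where "e \<in> one_units 1" "u (Suc n) = u n * e"
      using N[of 1 n] by auto
    then show ?case
      using step nz one_units_subdegree[of e] by simp
  qed (simp add: s_def)
  define K where "K m = max (N 1) (N m)" for m
  have stable: "u n - u (K m) \<in> fls_ideal (s + int m)" if "n \<ge> K m" for m n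
    using that
  proof (induction n rule: dec_induct)
    case (step n)
    then obtain e where e: "e \<in> one_units (int m)" "u (Suc n) = u n * e"
      using N[of m n] by (auto simp: K_def)
    have "u n * (e - 1) \<in> fls_ideal (s + int m)"
      using e sub[of n] step by (intro fls_ideal_mult) (auto simp: one_units_def fls_ideal_iff K_def)
    with step.IH have "(u n - u (K m)) + u n * (e - 1) \<in> fls_ideal (s + int m)"
      by (rule fls_ideal_add)
    then show ?case by (simp add: e algebra_simps)
  qed simp
  \<comment> \<open>For \<open>i \<ge> s\<close> the least level \<open>m\<close> with
    \<open>i < s + m\<close> is \<open>i - s + 1\<close>; from \<open>K m\<close> on, coefficient
    \<open>i\<close> no longer changes. For \<open>i < s\<close> level 0 suffices.\<close>
  define c where "c i = fls_nth (u (K (nat (i - s + 1)))) i" for i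
  define L where "L = Abs_fls c"
  have coeff: "fls_nth (u n) i = c i" if "n \<ge> K m" "i < s + int m" for n m i
  proof -
    have eq: "fls_nth (u n) i = fls_nth (u (K m)) i" if "n \<ge> K m" "i < s + int m" for n m
      using stable[OF that(1)] that(2) by (auto simp: fls_ideal_def)
    define n' where "n' = max n (K (nat (i - s + 1)))"
    have "fls_nth (u n) i = fls_nth (u n') i"
      using eq[OF that] eq[of m n'] that by (simp add: n'_def)
    also have "\<dots> = c i"
      unfolding c_def by (rule eq) (auto simp: n'_def)
    finally show ?thesis .
  qed
  have low: "c i = 0" if "i < s" for i
    using sub[of "K (nat (i - s + 1))"] that by (simp add: c_def K_def)
  have L: "fls_nth L i = c i" for i
    unfolding L_def by (rule nth_Abs_fls_lower_bound[of s]) (simp add: low)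
  have "u \<longlonglongrightarrow> L"
  proof (rule fls_tendsto)
    fix m
    have "u n - L \<in> fls_ideal m" if "n \<ge> K (nat (m - s))" for n
      using that coeff[OF that] by (auto simp: fls_ideal_def L)
    then show "\<forall>\<^sub>F n in sequentially. u n - L \<in> fls_ideal m"
      using eventually_sequentially by blast
  qed
  moreover have "L \<noteq> 0"
  proof -
    have "fls_nth (u (K 1)) s = c s"
      by (rule coeff) auto
    moreover have "fls_nth (u (K 1)) s \<noteq> 0"
      using sub[of "K 1"] nth_fls_subdegree_nonzero[OF nz] by (metis K_def max.cobounded1)
    ultimately show ?thesis using L by (metis fls_zero_nth)
  qed
  ultimately show ?thesis using that by blast
qed

section \<open>Non-vanishing of the period invariants\<close>

text \<open>Collects the properties of the ideals from which the nonvanishing of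
  \<open>eta_limit\<close> and \<open>u_limit\<close> is derived.\<close>

locale fls_lattice =
  fixes V :: "'a::{field,finite} fls set" and D :: int
  assumes subgroup: "add_subgroup V"
    and smult: "x \<in> V \<Longrightarrow> fls_const c * x \<in> V"
    and all_degrees: "D \<le> M \<Longrightarrow> \<exists>x\<in>V - {0}. vdeg x = M"
begin

definition bounded_part :: "int \<Rightarrow> 'a fls set" where
  "bounded_part M = V \<inter> fls_ideal (- M)"

definition layer :: "int \<Rightarrow> 'a fls set" where
  "layer M = {x \<in> V - {0}. vdeg x = M}"

text \<open>If \<open>W\<close> is a subspace, this is the orbit of \<open>x\<close> under a group
  of affine maps; taking a \<open>bounded_part\<close> for \<open>W\<close> partitions each layer of
  higher degree.\<close>

definition orbit :: "'a fls set \<Rightarrow> 'a fls \<Rightarrow> 'a fls set" where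
  "orbit W x = (\<lambda>(c, w). fls_const c * x + w) ` ((UNIV - {0}) \<times> W)"

lemma bounded_part_iff: "x \<in> bounded_part M \<longleftrightarrow> x \<in> V \<and> (x = 0 \<or> vdeg x \<le> M)"
  by (auto simp: bounded_part_def fls_ideal_iff vdeg_def)

lemma bounded_part_subgroup: "add_subgroup (bounded_part M)"
  using subgroup by (auto simp: bounded_part_def add_subgroup_def intro: fls_ideal_diff)

lemma bounded_part_smult: "x \<in> bounded_part M \<Longrightarrow> fls_const c * x \<in> bounded_part M"
  using smult[of x c] by (cases "x = 0"; cases "c = 0") (auto simp: bounded_part_iff vdeg_def)

lemma bounded_part_mono: "M \<le> M' \<Longrightarrow> bounded_part M \<subseteq> bounded_part M'"
  by (auto simp: bounded_part_iff)

lemma bounded_part_eq_layer_union: "bounded_part M = bounded_part (M - 1) \<union> layer M"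
  "bounded_part (M - 1) \<inter> layer M = {}"
  by (auto simp: bounded_part_iff layer_def add_subgroup_zero[OF subgroup])

lemma translate_nth:
  assumes "x \<in> layer M" "w \<in> bounded_part (M - 1)" "n \<le> - M"
  shows "fls_nth (fls_const c * x + w) n = (if n = - M then c * lead_sgn x else 0)"
proof -
  have "fls_nth w n = 0"
    using assms by (auto simp: bounded_part_def fls_ideal_def)
  then show ?thesis
    using assms by (auto simp: layer_def vdeg_def lead_sgn_def)
qed

lemma lead_sgn_nonzero: "x \<noteq> 0 \<Longrightarrow> lead_sgn x \<noteq> 0"
  by (simp add: lead_sgn_def)

lemma translate:
  assumes x: "x \<in> layer M" and w: "w \<in> bounded_part (M - 1)" and c: "c \<noteq> 0"
  shows "fls_const c * x + w \<in> layer M" "lead_sgn (fls_const c * x + w) = c * lead_sgn x"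
proof -
  let ?y = "fls_const c * x + w"
  have "c * lead_sgn x \<noteq> 0"
    using x c lead_sgn_nonzero by (auto simp: layer_def)
  then have nz: "fls_nth ?y (- M) \<noteq> 0"
    using translate_nth[OF x w] by simp
  then have sub: "fls_subdegree ?y = - M"
    using translate_nth[OF x w] by (intro fls_subdegree_eqI) auto
  have "?y \<in> V"
    using x w by (auto simp: layer_def bounded_part_iff intro!: add_subgroup_add[OF subgroup] smult)
  moreover have "?y \<noteq> 0" using nz by (metis fls_zero_nth)
  ultimately show "?y \<in> layer M"
    using sub by (simp add: layer_def vdeg_def)
  show "lead_sgn ?y = c * lead_sgn x"
    using translate_nth[OF x w, of "- M"] sub by (simp add: lead_sgn_def)
qed

text \<open>The action is free: the leading coefficient \<open>c * lead_sgn x\<close> determines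
  \<open>c\<close>, and then \<open>w\<close> is determined.\<close>

lemma orbit_inj:
  assumes x: "x \<in> layer M" and W: "W \<subseteq> bounded_part (M - 1)"
  shows "inj_on (\<lambda>(c, w). fls_const c * x + w) ((UNIV - {0}) \<times> W)"
proof (rule inj_onI)
  fix p p' :: "'a \<times> 'a fls"
  obtain c w c' w' where p: "p = (c, w)" "p' = (c', w')"
    by (cases p, cases p')
  assume "p \<in> (UNIV - {0}) \<times> W" "p' \<in> (UNIV - {0}) \<times> W"
    and "(case p of (c, w) \<Rightarrow> fls_const c * x + w) = (case p' of (c, w) \<Rightarrow> fls_const c * x + w)"
  then have *: "w \<in> W" "w' \<in> W" "c \<noteq> 0" "c' \<noteq> 0"
    and eq: "fls_const c * x + w = fls_const c' * x + w'"
    by (auto simp: p)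
  have "c * lead_sgn x = c' * lead_sgn x"
    using translate(2)[OF x] * W eq by (metis subsetD)
  then have "c = c'"
    using x lead_sgn_nonzero[of x] by (simp add: layer_def)
  with eq show "p = p'" by (simp add: p)
qed

lemma prod_orbit:
  assumes "x \<in> layer M" "W \<subseteq> bounded_part (M - 1)"
  shows "prod h (orbit W x) = (\<Prod>c\<in>UNIV - {0}. \<Prod>w\<in>W. h (fls_const c * x + w))"
  unfolding orbit_def prod.reindex[OF orbit_inj[OF assms]]
  by (simp add: prod.cartesian_product case_prod_unfold)

text \<open>Subtracting from \<open>y\<close> the scalar multiple of \<open>x\<close> with the same
  leading coefficient lowers the degree, so all elements of lower degree together act
  transitively.\<close>

lemma orbit_full:
  assumes x: "x \<in> layer M"
  shows "orbit (bounded_part (M - 1)) x = layer M"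
proof
  show "orbit (bounded_part (M - 1)) x \<subseteq> layer M"
    using translate(1)[OF x] by (auto simp: orbit_def)
  show "layer M \<subseteq> orbit (bounded_part (M - 1)) x"
  proof
    fix y assume y: "y \<in> layer M"
    define c where "c = lead_sgn y / lead_sgn x"
    have sx: "lead_sgn x \<noteq> 0" and sy: "lead_sgn y \<noteq> 0"
      using x y lead_sgn_nonzero by (auto simp: layer_def)
    have "fls_nth (y - fls_const c * x) n = 0" if "n < - (M - 1)" for n
      using translate_nth[OF x, of 0 n c] translate_nth[OF y, of 0 n 1] that sx
        add_subgroup_zero[OF bounded_part_subgroup] by (auto simp: c_def)
    moreover have "y - fls_const c * x \<in> V"
      using x y by (auto simp: layer_def intro!: add_subgroup_diff[OF subgroup] smult)
    ultimately have "y - fls_const c * x \<in> bounded_part (M - 1)"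
      by (simp add: bounded_part_def fls_ideal_def)
    moreover have "c \<noteq> 0" using sx sy by (simp add: c_def)
    ultimately show "y \<in> orbit (bounded_part (M - 1)) x"
      unfolding orbit_def by (intro image_eqI[of _ _ "(c, y - fls_const c * x)"]) auto
  qed
qed

text \<open>By \<open>trans\<close> and \<open>sym\<close> the orbits partition the layer, so a
  multiplicatively closed property need only be checked on single orbits.\<close>

lemma prod_over_orbits:
  fixes h :: "'a fls \<Rightarrow> 'b::comm_monoid_mult"
  assumes fin: "finite (layer M)" and K: "K \<le> M - 1"
    and one: "1 \<in> U" and mult: "\<And>a b. a \<in> U \<Longrightarrow> b \<in> U \<Longrightarrow> a * b \<in> U"
    and orb: "\<And>x. x \<in> layer M \<Longrightarrow> prod h (orbit (bounded_part K) x) \<in> U"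
  shows "prod h (layer M) \<in> U"
proof -
  let ?O = "orbit (bounded_part K)"
  have KM: "bounded_part K \<subseteq> bounded_part (M - 1)"
    using K by (rule bounded_part_mono)
  have sub: "?O x \<subseteq> layer M" if "x \<in> layer M" for x
    using translate(1)[OF that] KM by (auto simp: orbit_def)
  have self: "x \<in> ?O x" for x
    unfolding orbit_def
    by (intro image_eqI[of _ _ "(1, 0)"]) (auto intro: add_subgroup_zero[OF bounded_part_subgroup])
  have trans: "?O z \<subseteq> ?O x" if z: "z \<in> ?O x" for x z
  proof
    fix y assume "y \<in> ?O z"
    then obtain c w c' w' where *: "c \<noteq> 0" "w \<in> bounded_part K" "z = fls_const c * x + w"
      "c' \<noteq> 0" "w' \<in> bounded_part K" "y = fls_const c' * z + w'"
      using z by (auto simp: orbit_def)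
    then have "y = fls_const (c' * c) * x + (fls_const c' * w + w')"
      by (simp add: algebra_simps flip: fls_const_mult_const)
    then show "y \<in> ?O x"
      using * bounded_part_smult add_subgroup_add[OF bounded_part_subgroup] unfolding orbit_def
      by (intro image_eqI[of _ _ "(c' * c, fls_const c' * w + w')"]) auto
  qed
  have sym: "x \<in> ?O z" if z: "z \<in> ?O x" for x z
  proof -
    obtain c w where *: "c \<noteq> 0" "w \<in> bounded_part K" "z = fls_const c * x + w"
      using z by (auto simp: orbit_def)
    have "fls_const (inverse c) * fls_const c = 1"
      using *(1) by (simp add: fls_const_mult_const)
    then have "fls_const (inverse c) * z = x + fls_const (inverse c) * w"
      by (simp add: *(3) distrib_left mult.assoc[symmetric])
    then have "x = fls_const (inverse c) * z + (- (fls_const (inverse c) * w))"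
      by simp
    then show ?thesis
      using * bounded_part_smult add_subgroup_uminus[OF bounded_part_subgroup] unfolding orbit_def
      by (intro image_eqI[of _ _ "(inverse c, - (fls_const (inverse c) * w))"]) auto
  qed
  have "layer M = \<Union> (?O ` layer M)"
    using sub self by blast
  then have "prod h (layer M) = prod h (\<Union> (?O ` layer M))"
    by simp
  also have "\<dots> = (prod \<circ> prod) h (?O ` layer M)"
  proof (rule prod.Union_disjoint)
    show "\<forall>A\<in>?O ` layer M. finite A"
      using sub fin finite_subset by blast
    show "\<forall>A\<in>?O ` layer M. \<forall>B\<in>?O ` layer M. A \<noteq> B \<longrightarrow> A \<inter> B = {}"
      using trans sym by blast
  qed
  also have "\<dots> = prod (prod h) (?O ` layer M)"
    by simp
  also have "\<dots> \<in> U"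
  proof -
    have "finite (?O ` layer M)" "\<forall>A\<in>?O ` layer M. prod h A \<in> U"
      using fin orb by auto
    then show ?thesis
      by (induction rule: finite_induct) (auto intro: one mult)
  qed
  finally show ?thesis .
qed

text \<open>The layer is a single free orbit, hence \<open>q - 1\<close> times as large as the part
  of lower degree.\<close>

lemma card_bounded_part_step:
  assumes "finite (bounded_part M)" "layer M \<noteq> {}"
  shows "card (bounded_part M) = CARD('a) * card (bounded_part (M - 1))"
proof -
  obtain x where x: "x \<in> layer M" using assms by blast
  have "card (layer M) = card ((UNIV - {0::'a}) \<times> bounded_part (M - 1))"
    unfolding orbit_full[OF x, symmetric] orbit_def
    by (rule card_image[OF orbit_inj[OF x order_refl]])
  then have "card (layer M) = (CARD('a) - 1) * card (bounded_part (M - 1))"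
    by (simp add: card_cartesian_product card_Diff_singleton)
  moreover have "card (bounded_part M) = card (bounded_part (M - 1)) + card (layer M)"
    using assms(1) bounded_part_eq_layer_union[of M] by (metis card_Un_disjoint finite_Un)
  ultimately show ?thesis
    using two_le_CARD_field[where 'a = 'a] by (simp add: algebra_simps)
qed

text \<open>Starting from the zero group below all degrees, each degree multiplies the size by
  \<open>q\<close> or leaves it unchanged.\<close>

lemma card_bounded_part_power:
  assumes fin: "\<And>M. finite (bounded_part M)"
  shows "\<exists>k. card (bounded_part M) = CARD('a) ^ k"
proof -
  have zero: "0 \<in> bounded_part M" for M
    by (rule add_subgroup_zero[OF bounded_part_subgroup])
  \<comment> \<open>\<open>M0\<close> is negative, so a nonzero element of degree at most
    \<open>M0\<close> would lie in the finite set \<open>bounded_part 0\<close>, whose nonzero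
    elements all have degree above \<open>M0\<close>.\<close>
  obtain M0 where M0: "\<And>x. x \<in> bounded_part 0 - {0} \<Longrightarrow> M0 < vdeg x" "M0 < 0"
  proof -
    define m where "m = Min (insert 0 (vdeg ` bounded_part 0)) - 1"
    have "m < vdeg x" if "x \<in> bounded_part 0" for x
    proof -
      have "Min (insert 0 (vdeg ` bounded_part 0)) \<le> vdeg x"
        using fin[of 0] that by (intro Min_le) auto
      then show ?thesis by (simp add: m_def)
    qed
    moreover have "Min (insert 0 (vdeg ` bounded_part 0)) \<le> 0"
      using fin[of 0] by (intro Min_le) auto
    ultimately show ?thesis using that[of m] by (auto simp: m_def)
  qed
  have base: "\<exists>k. card (bounded_part M) = CARD('a) ^ k" if "M \<le> M0" for M
  proof -
    have "bounded_part M = {0}"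
      using that M0 zero[of M] by (fastforce simp: bounded_part_iff)
    then show ?thesis by (intro exI[of _ 0]) simp
  qed
  show ?thesis
  proof (cases "M0 \<le> M")
    case True
    then show ?thesis
    proof (induction M rule: int_ge_induct)
      case (step M)
      then obtain k where k: "card (bounded_part M) = CARD('a) ^ k" by blast
      show ?case
      proof (cases "layer (M + 1) = {}")
        case True
        then have "bounded_part (M + 1) = bounded_part M" using bounded_part_eq_layer_union[of "M + 1"] by simp
        with k show ?thesis by auto
      next
        case False
        then have "card (bounded_part (M + 1)) = CARD('a) ^ Suc k"
          using card_bounded_part_step[OF fin False] k by simp
        then show ?thesis by blast
      qed
    qed (simp add: base)
  qed (simp add: base)
qed

text \<open>Each of the \<open>n\<close> degrees from \<open>D\<close> to \<open>D - 1 + n\<close>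
  occurs and contributes a factor \<open>q\<close>.\<close>

lemma card_bounded_part_growth:
  assumes fin: "\<And>M. finite (bounded_part M)"
  shows "\<exists>k\<ge>n. card (bounded_part (D - 1 + int n)) = CARD('a) ^ k"
proof (induction n)
  case 0
  then show ?case using card_bounded_part_power[OF fin] by simp
next
  case (Suc n)
  then obtain k where k: "k \<ge> n" "card (bounded_part (D - 1 + int n)) = CARD('a) ^ k" by blast
  have "layer (D + int n) \<noteq> {}"
    using all_degrees[of "D + int n"] by (auto simp: layer_def)
  then have "card (bounded_part (D + int n)) = CARD('a) * card (bounded_part (D + int n - 1))"
    by (rule card_bounded_part_step[OF fin])
  then have "card (bounded_part (D - 1 + int (Suc n))) = CARD('a) ^ Suc k"
    using k(2) by (simp add: algebra_simps)
  with k(1) show ?case by (intro exI[of _ "Suc k"]) auto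
qed

text \<open>The factor in \<open>u_limit\<close>. For a uniformizer \<open>\<pi>\<close> it has
  order 0, but its leading coefficient is that of a power of \<open>\<pi>\<close> and need not be
  1.\<close>

definition monic_part :: "'a fls \<Rightarrow> 'a fls \<Rightarrow> 'a fls" where
  "monic_part \<pi> x = x * \<pi> powi (vdeg x) / fls_const (lead_sgn x)"

text \<open>
  Translation by the elements of small degree changes \<open>monic_part \<pi>\<close> only by one-units of high
  level, and the number of these elements is a high power of \<open>q\<close>; hence already the product
  over a single orbit is close to 1.
\<close>
lemma prod_monic_part_layer:
  assumes fin: "\<And>M. finite (bounded_part M)" and \<pi>: "\<pi> \<noteq> 0" "fls_subdegree \<pi> = 1"
    and M: "D + 2 * int n \<le> M"
  shows "prod (monic_part \<pi>) (layer M) \<in> one_units (int n)"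
proof (rule prod_over_orbits)
  show "finite (layer M)"
    using fin[of M] bounded_part_eq_layer_union(1)[of M] by (metis finite_Un)
  let ?W = "bounded_part (D - 1 + int n)"
  show "D - 1 + int n \<le> M - 1" using M by simp
  then have WM: "?W \<subseteq> bounded_part (M - 1)" by (rule bounded_part_mono)
  fix x assume x: "x \<in> layer M"
  then have x0: "x \<noteq> 0" "vdeg x = M" by (auto simp: layer_def)
  obtain k where k: "k \<ge> n" "card ?W = CARD('a) ^ k"
    using card_bounded_part_growth[OF fin] by blast
  let ?g = "monic_part \<pi>"
  have split: "?g (fls_const c * x + w) = ?g x * (1 + w / (fls_const c * x))"
    if "c \<noteq> 0" "w \<in> ?W" for c w
  proof -
    have t: "vdeg (fls_const c * x + w) = M" "lead_sgn (fls_const c * x + w) = c * lead_sgn x"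
      using translate[OF x] that WM by (auto simp: layer_def)
    have "lead_sgn x \<noteq> 0" using lead_sgn_nonzero x0 by blast
    then show ?thesis
      using that x0 unfolding monic_part_def t x0(2)
      by (simp add: field_simps flip: fls_const_mult_const)
  qed
  \<comment> \<open>\<open>w\<close> has degree at most \<open>D - 1 + n\<close> and
    \<open>x\<close> degree at least \<open>D + 2 * n\<close>, so a nonzero quotient has order
    greater than \<open>n\<close>.\<close>
  have unit: "1 + w / (fls_const c * x) \<in> one_units (int n)" if "c \<noteq> 0" "w \<in> ?W" for c w
  proof -
    have "n \<le> fls_subdegree (w / (fls_const c * x))" if "w \<noteq> 0"
    proof -
      have "fls_subdegree (w / (fls_const c * x)) = fls_subdegree w - fls_subdegree x"
        using that x0 \<open>c \<noteq> 0\<close> by (subst fls_divide_subdegree) auto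
      then show ?thesis
        using that x0 M \<open>w \<in> ?W\<close> by (auto simp: bounded_part_iff vdeg_def)
    qed
    then show ?thesis by (auto simp: one_units_def fls_ideal_iff)
  qed
  \<comment> \<open>\<open>?g x\<close> is common to the whole orbit. The \<open>q - 1\<close>
    scalars turn it into a one-unit, which the \<open>card ?W\<close> translations raise to a high
    level.\<close>
  have "?g x ^ (CARD('a) - 1) \<in> one_units 1"
  proof (rule power_CARD_minus_1_one_unit)
    have "lead_sgn x \<noteq> 0" using lead_sgn_nonzero x0 by blast
    then show "?g x \<noteq> 0" "fls_subdegree (?g x) = 0"
      using x0 \<pi> by (simp_all add: monic_part_def fls_divide_subdegree vdeg_def)
  qed
  then have "(?g x ^ (CARD('a) - 1)) ^ card ?W \<in> one_units (int k + 1)"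
    unfolding k(2) by (rule one_units_power_CARD_power)
  then have gx: "(?g x ^ (CARD('a) - 1)) ^ card ?W \<in> one_units (int n)"
    using one_units_antimono[of "int n" "int k + 1"] k(1) by auto
  have "prod ?g (orbit ?W x)
      = (\<Prod>c\<in>UNIV - {0}. \<Prod>w\<in>?W. ?g x * (1 + w / (fls_const c * x)))"
    unfolding prod_orbit[OF x WM] by (intro prod.cong refl split) auto
  also have "\<dots> = (?g x ^ (CARD('a) - 1)) ^ card ?W *
      (\<Prod>c\<in>UNIV - {0}. \<Prod>w\<in>?W. 1 + w / (fls_const c * x))"
    by (simp add: prod.distrib card_Diff_singleton power_mult[symmetric] mult.commute)
  also have "\<dots> \<in> one_units (int n)"
    using unit by (intro one_units_mult gx one_units_prod) auto
  finally show "prod ?g (orbit ?W x) \<in> one_units (int n)" .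
qed (auto intro: one_units_mult)

text \<open>
  Discreteness of the ideals need not be shown: products over infinite sets are 1 by convention,
  so that the limits exist in the second case for trivial reasons.
\<close>
lemma bounded_part_cases:
  obtains (fin) "\<And>M. finite (bounded_part M)"
  | (inf) M0 where "\<And>M. M \<ge> M0 \<Longrightarrow> infinite (bounded_part M)"
proof (cases "\<forall>M. finite (bounded_part M)")
  case False
  then obtain M0 where "infinite (bounded_part M0)" by blast
  then have "infinite (bounded_part M)" if "M \<ge> M0" for M
    using bounded_part_mono[OF that] finite_subset by blast
  then show ?thesis by (rule inf)
qed (use fin in blast)

text \<open>Raising the degree bound by 1 multiplies the product by that over one layer, which for
  large degrees is a one-unit of any prescribed level.\<close>

lemma u_limit_nonzero:
  assumes \<pi>: "\<pi> \<noteq> 0" "fls_subdegree \<pi> = 1"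
  shows "u_limit \<pi> V \<noteq> 0"
proof -
  define u where "u M = prod (monic_part \<pi>) (bounded_part (int M) - {0})" for M :: nat
  have "{x \<in> V - {0}. vdeg x \<le> int M} = bounded_part (int M) - {0}" for M
    by (auto simp: bounded_part_iff)
  then have lim_u: "u_limit \<pi> V = lim u"
    by (simp add: u_limit_def u_def[abs_def] monic_part_def)
  have "\<exists>L. L \<noteq> 0 \<and> u \<longlonglongrightarrow> L"
  proof (cases rule: bounded_part_cases)
    case (inf M0)
    have "u M = 1" if "M \<ge> nat M0" for M
      using inf[of "int M"] that by (simp add: u_def)
    then have "u \<longlonglongrightarrow> 1"
      by (intro tendsto_eventually) (auto simp: eventually_sequentially)
    then show ?thesis by (intro exI[of _ 1]) simp
  next
    case fin
    have "u n \<noteq> 0" for n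
      using fin \<pi>(1) lead_sgn_nonzero by (auto simp: u_def monic_part_def)
    moreover have "\<exists>N. \<forall>n\<ge>N. \<exists>e\<in>one_units (int m). u (Suc n) = u n * e" for m
    proof (intro exI allI impI bexI)
      fix n assume n: "n \<ge> nat (D + 2 * int m)"
      show "prod (monic_part \<pi>) (layer (int (Suc n))) \<in> one_units (int m)"
        using n by (intro prod_monic_part_layer[OF fin \<pi>]) linarith
      have "bounded_part (int (Suc n)) - {0} = (bounded_part (int n) - {0}) \<union> layer (int (Suc n))"
        "(bounded_part (int n) - {0}) \<inter> layer (int (Suc n)) = {}"
        using bounded_part_eq_layer_union[of "int (Suc n)"] by (auto simp: layer_def)
      moreover have "finite (layer (int (Suc n)))"
        using fin[of "int (Suc n)"] bounded_part_eq_layer_union(1)[of "int (Suc n)"] by (metis finite_Un)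
      ultimately show "u (Suc n) = u n * prod (monic_part \<pi>) (layer (int (Suc n)))"
        using fin by (simp only: u_def) (subst prod.union_disjoint, auto)
    qed
    ultimately show ?thesis
      by (metis fls_product_converges)
  qed
  then show ?thesis
    unfolding lim_u by (metis limI)
qed

text \<open>A layer is a single orbit, in which each leading coefficient occurs a power of
  \<open>q\<close> times. Raising to that power is the identity on the finite field, so from degree
  \<open>D\<close> on the product is that of all nonzero scalars.\<close>

lemma eta_limit_nonzero: "eta_limit V \<noteq> 0"
proof -
  define h where "h M = (\<Prod>x\<in>layer (int M). fls_const (lead_sgn x))" for M :: nat
  have lim_h: "eta_limit V = lim h"
    by (simp add: eta_limit_def h_def[abs_def] layer_def)
  have sph: "\<exists>x. x \<in> layer M" if "D \<le> M" for M
    using all_degrees[OF that] by (auto simp: layer_def)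
  have "\<exists>L. L \<noteq> 0 \<and> h \<longlonglongrightarrow> L"
  proof (cases rule: bounded_part_cases)
    case (inf M0)
    \<comment> \<open>The bound \<open>M0 + 1\<close> makes \<open>bounded_part (M - 1)\<close>
      infinite; translated by \<open>x\<close> it lies in the layer, over which the product is then
      1.\<close>
    have "h M = 1" if M: "M \<ge> nat (max D (M0 + 1))" for M
    proof -
      obtain x where x: "x \<in> layer (int M)" using sph[of "int M"] M by force
      have "infinite ((\<lambda>w. x + w) ` bounded_part (int M - 1))"
        using inf[of "int M - 1"] M by (subst finite_image_iff) auto
      moreover have "(\<lambda>w. x + w) ` bounded_part (int M - 1) \<subseteq> layer (int M)"
        using translate(1)[OF x, of _ 1] by auto
      ultimately have "infinite (layer (int M))"
        using finite_subset by blast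
      then show ?thesis by (simp add: h_def)
    qed
    then have "h \<longlonglongrightarrow> 1"
      by (intro tendsto_eventually) (auto simp: eventually_sequentially)
    then show ?thesis by (intro exI[of _ 1]) simp
  next
    case fin
    define P where "P = (\<Prod>c\<in>UNIV - {0::'a}. fls_const c)"
    have "h M = P" if M: "M \<ge> nat D" for M
    proof -
      obtain x where x: "x \<in> layer (int M)" using sph[of "int M"] M by force
      let ?W = "bounded_part (int M - 1)"
      obtain k where k: "card ?W = CARD('a) ^ k" using card_bounded_part_power[OF fin] by blast
      have sx: "lead_sgn x \<noteq> 0" using x lead_sgn_nonzero by (auto simp: layer_def)
      have "h M = (\<Prod>c\<in>UNIV - {0}. \<Prod>w\<in>?W. fls_const (lead_sgn (fls_const c * x + w)))"
        unfolding h_def orbit_full[OF x, symmetric] by (rule prod_orbit[OF x order_refl])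
      also have "\<dots> = (\<Prod>c\<in>UNIV - {0}. fls_const ((c * lead_sgn x) ^ card ?W))"
        using translate(2)[OF x] by (intro prod.cong refl) (simp add: fls_const_power)
      also have "\<dots> = (\<Prod>c\<in>UNIV - {0}. fls_const (c * lead_sgn x))"
        unfolding k power_CARD_power ..
      also have "\<dots> = P"
        unfolding P_def by (rule prod.reindex_bij_witness[where i = "\<lambda>c. c / lead_sgn x" and j = "\<lambda>c. c * lead_sgn x"])
          (use sx in auto)
      finally show ?thesis .
    qed
    then have "h \<longlonglongrightarrow> P"
      by (intro tendsto_eventually) (auto simp: eventually_sequentially)
    moreover have "P \<noteq> 0" by (simp add: P_def)
    ultimately show ?thesis by blast
  qed
  then show ?thesis
    unfolding lim_h by (metis limI)
qed

end

text \<open>The power of \<open>\<xi>\<close> is the image of a nonzero series, whichever integer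
  \<open>t_exponent V\<close> is, and \<open>j\<close> maps invertible elements to invertible
  ones.\<close>

lemma period_nonzero:
  assumes j: "completed_alg_closure j" and V: "fls_lattice V D"
    and \<pi>: "fls_subdegree \<pi> = 1" and per: "is_period j \<pi> V \<xi>"
  shows "\<xi> \<noteq> 0"
proof
  assume "\<xi> = 0"
  define w where "w = inverse (eta_limit V) * \<pi> powi (- t_exponent V) * u_limit \<pi> V ^ (CARD('a) - 1)"
  have "\<pi> \<noteq> 0" using \<pi> by auto
  then have w: "w \<noteq> 0"
    using fls_lattice.eta_limit_nonzero[OF V] fls_lattice.u_limit_nonzero[OF V _ \<pi>]
    by (simp add: w_def)
  have "j (to_ac w) * j (to_ac (inverse w)) = j (to_ac w * to_ac (inverse w))"
    by (simp only: completed_alg_closure.j_mult[OF j])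
  also have "\<dots> = 1"
    using w completed_alg_closure.j_one[OF j] by simp
  finally have "j (to_ac w) * j (to_ac (inverse w)) = 1" .
  moreover have "j (to_ac w) = \<xi> ^ (CARD('a) - 1)"
    using per by (simp only: is_period_def w_def)
  then have "j (to_ac w) = 0"
    using \<open>\<xi> = 0\<close> two_le_CARD_field[where 'a = 'a] by (simp add: power_0_left)
  ultimately show False by simp
qed

section \<open>The ideals as lattices\<close>

lemma A_inf1_diff:
  assumes "x \<in> A_inf1 f d" "y \<in> A_inf1 f d"
  shows "x - y \<in> A_inf1 f d"
  using A_inf1.add[OF assms(1) A_inf1.mult[OF A_inf1.const[of "-1"] assms(2)]] by simp

lemma A_inf1_zero: "0 \<in> A_inf1 f d"
  using A_inf1.const[of 0] by simp

lemma A_inf1_power: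
  assumes "x \<in> A_inf1 f d"
  shows "x ^ n \<in> A_inf1 f d"
  using assms A_inf1.const[of 1] by (induction n) (auto intro: A_inf1.mult)

lemma ideal_a_mem: "(\<And>k. k \<le> i \<Longrightarrow> c k \<in> A_inf1 f d) \<Longrightarrow> (\<Sum>k\<le>i. c k * (f * fls_X_inv ^ k)) \<in> ideal_a f d i"
  by (auto simp: ideal_a_def)

text \<open>Only the generator of index 0 is used, so the same witness works for every
  \<open>i\<close>.\<close>

lemma ideal_a_mult_f:
  assumes "x \<in> A_inf1 f d"
  shows "f * x \<in> ideal_a f d i"
proof -
  have "(\<Sum>k\<le>i. (if k = 0 then x else 0) * (f * fls_X_inv ^ k)) \<in> ideal_a f d i"
    using assms A_inf1_zero by (intro ideal_a_mem) auto
  also have "(\<Sum>k\<le>i. (if k = 0 then x else 0) * (f * fls_X_inv ^ k)) = (\<Sum>k\<le>i. if k = 0 then f * x else 0)"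
    by (intro sum.cong) (auto simp: mult.commute)
  also have "\<dots> = f * x"
    by simp
  finally show ?thesis .
qed

text \<open>With \<open>r < d\<close>, the product of \<open>f\<close>,
  \<open>f * fls_X_inv ^ r\<close> and \<open>f ^ s\<close> has degree
  \<open>2 * d + r + s * d\<close>; division with remainder by \<open>d\<close> reaches every degree
  from \<open>2 * d\<close> on.\<close>

lemma ideal_a_lattice:
  assumes d: "d \<ge> 1" and f: "f \<noteq> 0" "vdeg f = int d"
  shows "fls_lattice (ideal_a f d i) (2 * int d)"
proof
  show "add_subgroup (ideal_a f d i)"
    unfolding add_subgroup_def
  proof (intro conjI ballI)
    show "0 \<in> ideal_a f d i"
      using ideal_a_mult_f[OF A_inf1_zero] by simp
    fix x y assume "x \<in> ideal_a f d i" "y \<in> ideal_a f d i"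
    then obtain c c' where "\<forall>k\<le>i. c k \<in> A_inf1 f d" "\<forall>k\<le>i. c' k \<in> A_inf1 f d"
      and xy: "x = (\<Sum>k\<le>i. c k * (f * fls_X_inv ^ k))" "y = (\<Sum>k\<le>i. c' k * (f * fls_X_inv ^ k))"
      unfolding ideal_a_def by auto
    then have "(\<Sum>k\<le>i. (c k - c' k) * (f * fls_X_inv ^ k)) \<in> ideal_a f d i"
      by (intro ideal_a_mem A_inf1_diff) auto
    then show "x - y \<in> ideal_a f d i"
      by (simp add: xy left_diff_distrib sum_subtractf)
  qed
next
  fix x c assume "x \<in> ideal_a f d i"
  then obtain e where "\<forall>k\<le>i. e k \<in> A_inf1 f d" and x: "x = (\<Sum>k\<le>i. e k * (f * fls_X_inv ^ k))"
    unfolding ideal_a_def by auto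
  then have "(\<Sum>k\<le>i. (fls_const c * e k) * (f * fls_X_inv ^ k)) \<in> ideal_a f d i"
    by (intro ideal_a_mem A_inf1.mult A_inf1.const) auto
  then show "fls_const c * x \<in> ideal_a f d i"
    by (simp add: x sum_distrib_left mult.assoc)
next
  fix M :: int assume M: "2 * int d \<le> M"
  define m where "m = nat (M - 2 * int d)"
  define x where "x = f * (f * fls_X_inv ^ (m mod d) * f ^ (m div d))"
  have "f \<in> A_inf1 f d"
    using A_inf1.gen[of 0 d f] d by simp
  then have "f * fls_X_inv ^ (m mod d) * f ^ (m div d) \<in> A_inf1 f d"
    using d by (intro A_inf1.mult A_inf1.gen A_inf1_power) auto
  then have "x \<in> ideal_a f d i"
    unfolding x_def by (rule ideal_a_mult_f)
  moreover have "x \<noteq> 0"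
    using f by (simp add: x_def)
  moreover have "vdeg x = M"
  proof -
    have "vdeg x = 2 * int d + int (m mod d) + int (m div d) * int d"
    proof -
      have "fls_subdegree f = - int d" using f by (simp add: vdeg_def)
      with f show ?thesis by (simp add: x_def vdeg_def fls_subdegree_pow)
    qed
    also have "\<dots> = 2 * int d + int (m div d * d + m mod d)"
      by (simp only: of_nat_add of_nat_mult)
    also have "\<dots> = M"
      unfolding div_mult_mod_eq using M by (simp add: m_def)
    finally show ?thesis .
  qed
  ultimately show "\<exists>x\<in>ideal_a f d i - {0}. vdeg x = M" by blast
qed

section \<open>Finite index\<close>

lemma of_A_nth: "fls_nth (of_A P) n = (if n \<le> 0 then Polynomial.coeff P (nat (- n)) else 0)"
proof (induction P arbitrary: n)
  case 0
  then show ?case by (simp add: of_A_def)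
next
  case (pCons a P)
  have "of_A (pCons a P) = fls_const a + fls_X_inv * of_A P"
    using pCons.hyps by (simp add: of_A_def map_poly_pCons)
  then have "fls_nth (of_A (pCons a P)) n = (if n = 0 then a else 0) + fls_nth (of_A P) (n + 1)"
    by (simp add: fls_X_inv_times_conv_shift)
  also have "\<dots> = (if n \<le> 0 then Polynomial.coeff (pCons a P) (nat (- n)) else 0)"
  proof (cases "n < 0")
    case True
    then have "nat (- n) = Suc (nat (- (n + 1)))" by simp
    with True pCons.IH[of "n + 1"] show ?thesis by simp
  qed (use pCons.IH[of "n + 1"] in auto)
  finally show ?case .
qed

lemma range_of_A: "range of_A = {x. \<forall>n>0. fls_nth x n = 0}"
proof (intro subset_antisym subsetI)
  fix x :: "'a fls" assume "x \<in> {x. \<forall>n>0. fls_nth x n = 0}"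
  then have x: "fls_nth x n = 0" if "n > 0" for n using that by simp
  define P where "P = Abs_poly (\<lambda>i. fls_nth x (- int i))"
  have "Polynomial.coeff P i = fls_nth x (- int i)" for i
    unfolding P_def by (subst Abs_poly_inverse) auto
  then have "of_A P = x"
    using x by (intro fls_eqI) (auto simp: of_A_nth)
  then show "x \<in> range of_A" by blast
qed (auto simp: of_A_nth)

lemma add_subgroup_range_of_A: "add_subgroup (range of_A)"
  by (auto simp: add_subgroup_def range_of_A)

lemma fls_ideal_extend:
  assumes "x \<in> fls_ideal 1" "\<And>n. 1 \<le> n \<Longrightarrow> n \<le> m \<Longrightarrow> fls_nth x n = 0"
  shows "x \<in> fls_ideal (m + 1)"
proof -
  have "fls_nth x n = 0" if "n < m + 1" for n
    using assms that by (cases "n < 1") (auto simp: fls_ideal_def)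
  then show ?thesis by (simp add: fls_ideal_def)
qed

lemma polynomial_part: "\<exists>P\<in>range of_A. s - P \<in> fls_ideal 1"
proof
  define P where "P = Abs_fls (\<lambda>n. if n \<le> 0 then fls_nth s n else 0)"
  have nth: "fls_nth P n = (if n \<le> 0 then fls_nth s n else 0)" for n
    unfolding P_def by (rule nth_Abs_fls_lower_bound[of "fls_subdegree s"]) auto
  then show "P \<in> range of_A" "s - P \<in> fls_ideal 1"
    by (auto simp: range_of_A fls_ideal_def)
qed

text \<open>Only the coefficients at indices from \<open>m\<close> to 0 can be nonzero, and each
  takes finitely many values.\<close>

lemma finite_range_of_A_bounded: "finite (range of_A \<inter> fls_ideal m :: 'a::{field,finite} fls set)"
proof (rule finite_imageD)
  let ?c = "\<lambda>x :: 'a fls. map (fls_nth x) [m..0]"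
  have "?c ` (range of_A \<inter> fls_ideal m) \<subseteq> {xs. set xs \<subseteq> UNIV \<and> length xs = length [m..0]}"
    by auto
  then show "finite (?c ` (range of_A \<inter> fls_ideal m))"
    by (rule finite_subset) (rule finite_lists_length_eq, simp)
  show "inj_on ?c (range of_A \<inter> fls_ideal m)"
  proof (rule inj_onI)
    fix x y assume *: "x \<in> range of_A \<inter> fls_ideal m" "y \<in> range of_A \<inter> fls_ideal m" "?c x = ?c y"
    show "x = y"
    proof (rule fls_eqI)
      fix n
      consider "n < m" | "n > 0" | "n \<in> {m..0}" by fastforce
      then show "fls_nth x n = fls_nth y n"
        using * by cases (auto simp: range_of_A fls_ideal_def)
    qed
  qed
qed

text \<open>Nonzero absolute values are integral powers of \<open>q\<close>, so the strict
  inequality shifts the exponent by one.\<close>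

lemma vabs_less_powi_iff:
  fixes x :: "'a::{field,finite} fls"
  shows "vabs x < real CARD('a) powi m \<longleftrightarrow> x \<in> fls_ideal (1 - m)"
proof -
  have "1 < real CARD('a)" using two_le_CARD_field[where 'a = 'a] by simp
  then have less: "real CARD('a) powi i < real CARD('a) powi m \<longleftrightarrow> i < m" for i
    using power_int_strict_increasing[of i m "real CARD('a)"]
      power_int_strict_increasing[of m i "real CARD('a)"]
    by (cases i m rule: linorder_cases) simp_all
  show ?thesis
  proof (cases "x = 0")
    case False
    then have "vabs x < real CARD('a) powi m \<longleftrightarrow> - fls_subdegree x < m"
      unfolding vabs_def using less by simp
    then show ?thesis
      using False unfolding fls_ideal_iff by linarith
  qed (simp add: vabs_def)
qed

lemma ex_powi_less:
  assumes "1 < q" "0 < r"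
  shows "\<exists>k::nat. q powi (- int k) < (r :: real)"
  using reals_power_lt_ex[OF assms(2,1)] by (auto simp: power_int_minus power_inverse inverse_eq_divide power_one_over)

lemma ex_less_powi:
  assumes "1 < (q :: real)"
  shows "\<exists>k::nat. r < q powi int k"
  using real_arch_pow[OF assms] by auto

text \<open>Here \<open>y\<close> has to be the polynomial part of \<open>x * f\<close>, so the
  condition says that the coefficients of \<open>x * f\<close> at indices 1 to \<open>k\<close>
  vanish.\<close>

lemma Lambda_powi_iff:
  fixes f :: "'a::{field,finite} fls"
  shows "x \<in> Lambda f (real CARD('a) powi (- int k)) \<longleftrightarrow>
    x \<in> range of_A \<and> (\<exists>y\<in>range of_A. x * f - y \<in> fls_ideal (int k + 1))"
  by (simp add: Lambda_def vabs_less_powi_iff add.commute)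

lemma add_subgroup_Lambda:
  fixes f :: "'a::{field,finite} fls"
  shows "add_subgroup (Lambda f (real CARD('a) powi (- int k)))"
  unfolding add_subgroup_def
proof (intro conjI ballI)
  note A = add_subgroup_range_of_A[where 'a = 'a]
  show "0 \<in> Lambda f (real CARD('a) powi (- int k))"
    unfolding Lambda_powi_iff using add_subgroup_zero[OF A] by (intro conjI bexI[of _ 0]) auto
  fix x x' assume *: "x \<in> Lambda f (real CARD('a) powi (- int k))" "x' \<in> Lambda f (real CARD('a) powi (- int k))"
  then obtain y y' where y: "y \<in> range of_A" "x * f - y \<in> fls_ideal (int k + 1)"
    "y' \<in> range of_A" "x' * f - y' \<in> fls_ideal (int k + 1)"
    unfolding Lambda_powi_iff by blast
  from fls_ideal_diff[OF y(2,4)] have "(x - x') * f - (y - y') \<in> fls_ideal (int k + 1)"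
    by (simp add: algebra_simps)
  with * y show "x - x' \<in> Lambda f (real CARD('a) powi (- int k))"
    unfolding Lambda_powi_iff using add_subgroup_diff[OF A] by blast
qed

section \<open>Cosets and finite quotients\<close>

lemma coset_rel_equiv:
  assumes "add_subgroup L"
  shows "equiv M (coset_rel M L)"
proof (rule equivI)
  show "coset_rel M L \<subseteq> M \<times> M" by (auto simp: coset_rel_def)
  show "refl_on M (coset_rel M L)"
    using add_subgroup_zero[OF assms] by (auto simp: refl_on_def coset_rel_def)
  show "sym (coset_rel M L)"
    using add_subgroup_uminus[OF assms] by (fastforce intro!: symI simp: coset_rel_def)
  show "trans (coset_rel M L)"
    using add_subgroup_add[OF assms] by (fastforce intro!: transI simp: coset_rel_def)
qed

text \<open>Choosing one preimage for each value of \<open>\<psi>\<close> already meets every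
  class.\<close>

lemma finite_quotient_coset_rel:
  assumes L: "add_subgroup L" and fin: "finite (\<psi> ` I)"
    and sep: "\<And>x y. x \<in> I \<Longrightarrow> y \<in> I \<Longrightarrow> \<psi> x = \<psi> y \<Longrightarrow> g x - g y \<in> L"
  shows "finite (g ` I // coset_rel (g ` I) L)"
proof (rule finite_subset)
  let ?r = "coset_rel (g ` I) L"
  let ?c = "\<lambda>v. ?r `` {g (SOME x. x \<in> I \<and> \<psi> x = v)}"
  show "g ` I // ?r \<subseteq> ?c ` \<psi> ` I"
  proof
    fix C assume "C \<in> g ` I // ?r"
    then obtain x where x: "x \<in> I" "C = ?r `` {g x}" by (auto simp: quotient_def)
    define y where "y = (SOME y. y \<in> I \<and> \<psi> y = \<psi> x)"
    have y: "y \<in> I \<and> \<psi> y = \<psi> x"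
      unfolding y_def by (rule someI[of _ x]) (use x in simp)
    then have "(g x, g y) \<in> ?r"
      using x sep[of x y] by (auto simp: coset_rel_def)
    then have "C = ?c (\<psi> x)"
      using equiv_class_eq[OF coset_rel_equiv[OF L]] x(2) by (metis y_def)
    with x show "C \<in> ?c ` \<psi> ` I" by blast
  qed
  show "finite (?c ` \<psi> ` I)" using fin by simp
qed

lemma finite_nonzero_class_reps:
  assumes L: "add_subgroup L" and fin: "finite (M // coset_rel M L)" and R: "nonzero_class_reps M L R"
  shows "finite R"
proof (rule finite_imageD)
  let ?c = "\<lambda>r. coset_rel M L `` {r}"
  have RM: "R \<subseteq> M - L" using R by (simp add: nonzero_class_reps_def)
  show "finite (?c ` R)"
    by (rule finite_subset[OF _ fin]) (use RM in \<open>auto intro: quotientI\<close>)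
  show "inj_on ?c R"
  proof (rule inj_onI)
    fix r s assume rs: "r \<in> R" "s \<in> R" "?c r = ?c s"
    then have "(r, s) \<in> coset_rel M L" "(s, s) \<in> coset_rel M L"
      using eq_equiv_class_iff[OF coset_rel_equiv[OF L], of r M s] eq_equiv_class_iff[OF coset_rel_equiv[OF L], of s M s] RM
      by auto
    moreover have "\<exists>!r. r \<in> R \<and> (r, s) \<in> coset_rel M L"
      using R RM rs(2) unfolding nonzero_class_reps_def by blast
    ultimately show "r = s" using rs by blast
  qed
qed

section \<open>Images of lattices in the completed closure\<close>

context completed_alg_closure
begin

sublocale ultrametric_field "TYPE('c)"
  by unfold_locales (fact dist_eq_cabs cabs_mult cabs_ultrametric)+

lemma j_ac_diff: "j (to_ac (x - y)) = j (to_ac x) - j (to_ac y)"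
  using j_add[of "to_ac (x - y)" "to_ac y"] by (simp add: algebra_simps)

lemma j_ac_zero: "j (to_ac 0) = 0"
  using j_ac_diff[of 0 0] by simp

lemma j_ac_inverse: "x \<noteq> 0 \<Longrightarrow> j (to_ac (inverse x)) = inverse (j (to_ac x))"
  using j_mult[of "to_ac (inverse x)" "to_ac x"] j_one
  by (intro inverse_unique[symmetric]) (simp add: mult.commute)

lemma add_subgroup_image:
  assumes "add_subgroup \<Lambda>"
  shows "add_subgroup ((\<lambda>x. \<kappa> * j (to_ac x)) ` \<Lambda>)"
  unfolding add_subgroup_def
proof (intro conjI ballI)
  show "0 \<in> (\<lambda>x. \<kappa> * j (to_ac x)) ` \<Lambda>"
    using add_subgroup_zero[OF assms] j_ac_zero by (intro image_eqI[of _ _ 0]) auto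
  fix u v assume "u \<in> (\<lambda>x. \<kappa> * j (to_ac x)) ` \<Lambda>" "v \<in> (\<lambda>x. \<kappa> * j (to_ac x)) ` \<Lambda>"
  then obtain x y where "x \<in> \<Lambda>" "y \<in> \<Lambda>" "u = \<kappa> * j (to_ac x)" "v = \<kappa> * j (to_ac y)" by blast
  then show "u - v \<in> (\<lambda>x. \<kappa> * j (to_ac x)) ` \<Lambda>"
    using add_subgroup_diff[OF assms]
    by (intro image_eqI[of _ _ "x - y"]) (simp_all only: j_ac_diff right_diff_distrib)
qed

text \<open>For \<open>\<kappa> \<noteq> 0\<close> a bound on the image bounds the degree of the
  polynomial \<open>x\<close>, which leaves finitely many; for \<open>\<kappa> = 0\<close> the image
  has at most one element.\<close>

lemma discrete_image:
  assumes "\<Lambda> \<subseteq> range of_A"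
  shows "discrete ((\<lambda>x. \<kappa> * j (to_ac x)) ` \<Lambda>)"
proof (cases "\<kappa> = 0")
  case True
  then show ?thesis
    unfolding discrete_def by (auto intro!: finite_subset[of _ "{0}"])
next
  case False
  show ?thesis
    unfolding discrete_def
  proof
    fix r :: real
    have "1 < real CARD('a)" using two_le_CARD_field[where 'a = 'a] by simp
    then obtain k where k: "r / cabs \<kappa> < real CARD('a) powi int k"
      using ex_less_powi by blast
    have "{w \<in> (\<lambda>x. \<kappa> * j (to_ac x)) ` \<Lambda>. cabs w \<le> r}
        \<subseteq> (\<lambda>x. \<kappa> * j (to_ac x)) ` (range of_A \<inter> fls_ideal (1 - int k))"
    proof (intro subsetI; clarify)
      fix x assume x: "x \<in> \<Lambda>" "cabs (\<kappa> * j (to_ac x)) \<le> r"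
      then have "vabs x \<le> r / cabs \<kappa>"
        using False by (simp add: cabs_mult cabs_extends field_simps)
      with k have "x \<in> fls_ideal (1 - int k)"
        by (simp flip: vabs_less_powi_iff)
      with x assms show "\<kappa> * j (to_ac x) \<in> (\<lambda>x. \<kappa> * j (to_ac x)) ` (range of_A \<inter> fls_ideal (1 - int k))"
        by blast
    qed
    then show "finite {w \<in> (\<lambda>x. \<kappa> * j (to_ac x)) ` \<Lambda>. cabs w \<le> r}"
      using finite_range_of_A_bounded finite_subset by blast
  qed
qed

text \<open>A strict bound on an infimum is met by a single element. The subgroup is nonempty, which
  excludes the default value 0 of \<open>infdist\<close> on the empty set.\<close>

lemma Lambda_tilde_iff:
  assumes "add_subgroup (L :: 'c set)"
  shows "x \<in> Lambda_tilde \<alpha> \<delta> L \<longleftrightarrow> x \<in> scaled \<alpha> L \<and> (\<exists>y\<in>L. cabs (x - y) < \<delta>)"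
proof -
  have "L \<noteq> {}" using add_subgroup_zero[OF assms] by blast
  then have "infdist x L < \<delta> \<longleftrightarrow> (\<exists>y\<in>L. dist x y < \<delta>)"
    unfolding infdist_notempty[OF \<open>L \<noteq> {}\<close>]
    by (subst cINF_less_iff) (auto intro: bdd_belowI[of _ 0])
  then show ?thesis
    by (simp add: Lambda_tilde_def dist_eq_cabs)
qed

text \<open>The ultrametric inequality preserves the bound \<open>\<delta>\<close> under
  differences.\<close>

lemma add_subgroup_Lambda_tilde:
  assumes L: "add_subgroup (L :: 'c set)" and M: "add_subgroup (scaled \<alpha> L)" and \<delta>: "0 < \<delta>"
  shows "add_subgroup (Lambda_tilde \<alpha> \<delta> L)"
  unfolding add_subgroup_def
proof (intro conjI ballI)
  show "0 \<in> Lambda_tilde \<alpha> \<delta> L"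
    unfolding Lambda_tilde_iff[OF L]
    using add_subgroup_zero[OF L] add_subgroup_zero[OF M] \<delta> by (intro conjI bexI[of _ 0]) auto
  fix x x' assume *: "x \<in> Lambda_tilde \<alpha> \<delta> L" "x' \<in> Lambda_tilde \<alpha> \<delta> L"
  then obtain y y' where y: "y \<in> L" "cabs (x - y) < \<delta>" "y' \<in> L" "cabs (x' - y') < \<delta>"
    unfolding Lambda_tilde_iff[OF L] by blast
  have "cabs ((x - y) - (x' - y')) < \<delta>"
    using cabs_ultrametric_diff[of "x - y" "x' - y'"] y by simp
  then have "cabs ((x - x') - (y - y')) < \<delta>"
    by (simp add: algebra_simps)
  with * y show "x - x' \<in> Lambda_tilde \<alpha> \<delta> L"
    unfolding Lambda_tilde_iff[OF L] using add_subgroup_diff[OF L] add_subgroup_diff[OF M] by blast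
qed

text \<open>
  The class of \<open>x/\<alpha>\<close> is determined by finitely many coefficients of \<open>x/\<alpha>\<close> and of \<open>P f\<close>, where
  \<open>P\<close> is the polynomial part of \<open>x/\<alpha>\<close>: if all of these agree for two elements, the polynomial
  part of the difference lies in \<open>\<Lambda>\<close> and its fractional part is small.
\<close>
lemma finite_index_Lambda_tilde:
  fixes f \<alpha> :: "'a fls" and k :: nat and \<kappa> :: 'c
  assumes \<alpha>: "\<alpha> \<noteq> 0" and \<delta>: "0 < \<delta>"
  defines "\<Lambda> \<equiv> Lambda f (real CARD('a) powi (- int k))"
  defines "L \<equiv> (\<lambda>x. \<kappa> * j (to_ac x)) ` \<Lambda>"
  shows "finite (scaled (j (to_ac \<alpha>)) L // coset_rel (scaled (j (to_ac \<alpha>)) L) (Lambda_tilde (j (to_ac \<alpha>)) \<delta> L))"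
proof -
  have L: "add_subgroup L"
    unfolding L_def \<Lambda>_def by (intro add_subgroup_image add_subgroup_Lambda)
  define g where "g x = \<kappa> * j (to_ac (inverse \<alpha> * x))" for x
  have scaled: "scaled (j (to_ac \<alpha>)) L = g ` \<Lambda>"
    by (simp add: scaled_def L_def g_def image_image j_mult j_ac_inverse[OF \<alpha>] mult.left_commute
        del: to_ac_inverse)
  have "g = (\<lambda>x. (\<kappa> * inverse (j (to_ac \<alpha>))) * j (to_ac x))"
    by (simp add: g_def[abs_def] j_mult j_ac_inverse[OF \<alpha>] mult.assoc del: to_ac_inverse)
  then have M: "add_subgroup (scaled (j (to_ac \<alpha>)) L)"
    unfolding scaled \<Lambda>_def using add_subgroup_image[OF add_subgroup_Lambda] by simp
  have q1: "1 < real CARD('a)" using two_le_CARD_field[where 'a = 'a] by simp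
  \<comment> \<open>\<open>m\<close> is so large that series of order above \<open>m\<close> fall
    below \<open>\<delta>\<close> after multiplication by \<open>\<kappa>\<close>.\<close>
  obtain m :: nat where m: "\<And>e. e \<in> fls_ideal (int m + 1) \<Longrightarrow> cabs (\<kappa> * j (to_ac e)) < \<delta>"
  proof (cases "\<kappa> = 0")
    case False
    then obtain m :: nat where m: "real CARD('a) powi (- int m) < \<delta> / cabs \<kappa>"
      using ex_powi_less[OF q1, of "\<delta> / cabs \<kappa>"] \<delta> by auto
    have "cabs (\<kappa> * j (to_ac e)) < \<delta>" if e: "e \<in> fls_ideal (int m + 1)" for e
    proof -
      have "vabs e < real CARD('a) powi (- int m)"
        using e by (simp add: vabs_less_powi_iff add.commute)
      with m have "vabs e < \<delta> / cabs \<kappa>" by simp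
      then show ?thesis
        using False by (simp add: cabs_mult cabs_extends field_simps)
    qed
    then show ?thesis by (rule that)
  qed (use that[of 0] \<delta> in simp)
  obtain pp where pp: "pp s \<in> range of_A" "s - pp s \<in> fls_ideal 1" for s :: "'a fls"
    using polynomial_part by metis
  define \<psi> where "\<psi> x = map (fls_nth (inverse \<alpha> * x)) [1..int m] @
    map (fls_nth (pp (inverse \<alpha> * x) * f)) [1..int k]" for x
  show ?thesis
    unfolding scaled
  proof (rule finite_quotient_coset_rel[where \<psi> = \<psi>])
    show "add_subgroup (Lambda_tilde (j (to_ac \<alpha>)) \<delta> L)"
      by (rule add_subgroup_Lambda_tilde[OF L M \<delta>])
    have "\<psi> ` \<Lambda> \<subseteq> {xs. set xs \<subseteq> UNIV \<and> length xs = m + k}"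
      by (auto simp: \<psi>_def)
    then show "finite (\<psi> ` \<Lambda>)"
      by (rule finite_subset) (rule finite_lists_length_eq, simp)
    fix x y assume xy: "x \<in> \<Lambda>" "y \<in> \<Lambda>" "\<psi> x = \<psi> y"
    let ?s = "inverse \<alpha> * x" and ?t = "inverse \<alpha> * y"
    have eq1: "fls_nth ?s n = fls_nth ?t n" if "1 \<le> n" "n \<le> int m" for n
      using xy(3) that by (auto simp: \<psi>_def)
    have eq2: "fls_nth (pp ?s * f) n = fls_nth (pp ?t * f) n" if "1 \<le> n" "n \<le> int k" for n
      using xy(3) that by (auto simp: \<psi>_def)
    \<comment> \<open>\<open>\<kappa> * j (to_ac P)\<close> will be the element of \<open>L\<close>
      close to \<open>g x - g y\<close>.\<close>
    define P where "P = pp ?s - pp ?t"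
    have PA: "P \<in> range of_A"
      unfolding P_def by (intro add_subgroup_diff[OF add_subgroup_range_of_A] pp)
    have small: "(?s - ?t) - P \<in> fls_ideal (int m + 1)"
    proof -
      have "(?s - pp ?s) - (?t - pp ?t) \<in> fls_ideal 1"
        by (intro fls_ideal_diff pp)
      then have "(?s - ?t) - P \<in> fls_ideal 1"
        by (simp add: P_def algebra_simps)
      moreover have "fls_nth ((?s - ?t) - P) n = 0" if "1 \<le> n" "n \<le> int m" for n
        using eq1[OF that] PA that by (auto simp: range_of_A)
      ultimately show ?thesis by (rule fls_ideal_extend)
    qed
    \<comment> \<open>At indices 1 to \<open>k\<close> the coefficients of \<open>P * f\<close>
      cancel by \<open>eq2\<close>, so its polynomial part \<open>y'\<close> witnesses that
      \<open>P\<close> lies in \<open>\<Lambda>\<close>.\<close>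
    obtain y' where y': "y' \<in> range of_A" "P * f - y' \<in> fls_ideal 1"
      using polynomial_part by blast
    have "P * f - y' \<in> fls_ideal (int k + 1)"
    proof -
      have "fls_nth (P * f - y') n = 0" if "1 \<le> n" "n \<le> int k" for n
        using eq2[OF that] y'(1) that by (auto simp: range_of_A P_def left_diff_distrib)
      with y'(2) show ?thesis by (rule fls_ideal_extend)
    qed
    then have "\<kappa> * j (to_ac P) \<in> L"
      unfolding L_def \<Lambda>_def using PA y'(1) Lambda_powi_iff by blast
    moreover have "g x - g y - \<kappa> * j (to_ac P) = \<kappa> * j (to_ac ((?s - ?t) - P))"
      unfolding g_def j_ac_diff by (simp add: algebra_simps)
    then have "cabs (g x - g y - \<kappa> * j (to_ac P)) < \<delta>"
      using m[OF small] by simp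
    moreover have "g x - g y \<in> scaled (j (to_ac \<alpha>)) L"
      using add_subgroup_diff[OF M] xy scaled by blast
    ultimately show "g x - g y \<in> Lambda_tilde (j (to_ac \<alpha>)) \<delta> L"
      unfolding Lambda_tilde_iff[OF L] by blast
  qed
qed

end

section \<open>The quotient formula for the period-normalised lattices\<close>

theorem theorem2:
  fixes j :: "'a::{field,finite} fls alg_closure \<Rightarrow> 'c::{field,complete_space}"
    and a :: "'a poly" and b :: 'a and d l :: nat
    and f \<pi> \<alpha> :: "'a fls" and \<xi> :: "'a fls set \<Rightarrow> 'c"
  assumes C_inf: "completed_alg_closure j"
    and a: "Polynomial.lead_coeff a = 1" "Polynomial.degree a = d" "d \<ge> 1"
    and b: "b \<noteq> 0"
    and f: "f\<^sup>2 - of_A a * f - fls_const b = 0" "vabs f = real CARD('a) ^ d"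
    and \<pi>: "if \<not> CHAR('a) dvd d then \<pi> ^ d = inverse f
            else \<pi> ^ (d + 1) = inverse (f * fls_X_inv)"
    and \<xi>_Lambda: "\<And>\<epsilon>. \<epsilon> > 0 \<Longrightarrow> is_period j \<pi> (Lambda f \<epsilon>) (\<xi> (Lambda f \<epsilon>))"
    and \<xi>_ideal: "\<And>i. i < d \<Longrightarrow> is_period j \<pi> (ideal_a f d i) (\<xi> (ideal_a f d i))"
    and l: "l < d"
    and \<alpha>: "\<alpha> \<in> A_inf1 f d" "\<alpha> \<noteq> 0"
  shows "\<exists>\<epsilon>0>0. \<forall>N. eps_Nl CARD('a) d N l < \<epsilon>0 \<longrightarrow>
    (let \<epsilon> = eps_Nl CARD('a) d N l;
         \<alpha>' = j (to_ac \<alpha>);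
         L = Lambda_breve j \<xi> f \<epsilon>;
         \<delta> = real CARD('a) powi (- int (d * N)) * \<epsilon> * cabs (\<xi> (ideal_a f d (d - 1 - l)));
         L' = Lambda_tilde \<alpha>' \<delta> L
     in finite (scaled \<alpha>' L // coset_rel (scaled \<alpha>' L) L') \<and>
        (\<forall>R. nonzero_class_reps (scaled \<alpha>' L) L' R \<longrightarrow>
          (\<forall>z. exp_lattice L (\<alpha>' * z) =
               \<alpha>' * exp_lattice L' z *
               (\<Prod>w\<in>R. 1 - exp_lattice L' z / exp_lattice L' w))))"
proof -
  interpret completed_alg_closure j by (rule C_inf)
  let ?q = "CARD('a)"
  have q1: "1 < real ?q" using two_le_CARD_field[where 'a = 'a] by simp
  have f0: "f \<noteq> 0"
    using f(2) q1 by (auto simp: vabs_def)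
  have "real ?q powi (- fls_subdegree f) = real ?q powi (int d)"
    using f(2) f0 by (simp add: vabs_def)
  then have df: "- fls_subdegree f = int d"
    using q1 power_int_strict_increasing[of _ _ "real ?q"] by (metis linorder_neqE order_less_irrefl)
  \<comment> \<open>\<open>\<pi>\<close> is a uniformizer in both cases: \<open>inverse f\<close>
    has order \<open>d\<close>, and \<open>inverse (f * fls_X_inv)\<close> has order
    \<open>d + 1\<close>.\<close>
  have sub\<pi>: "fls_subdegree \<pi> = 1"
  proof (cases "CHAR('a) dvd d")
    case False
    with \<pi> have "fls_subdegree (\<pi> ^ d) = fls_subdegree (inverse f)" by simp
    with df a(3) show ?thesis by (simp add: fls_subdegree_pow)
  next
    case True
    with \<pi> have "fls_subdegree (\<pi> ^ (d + 1)) = fls_subdegree (inverse (f * fls_X_inv))" by simp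
    also have "\<dots> = int d + 1"
      using df f0 by (simp del: nonzero_inverse_mult_distrib inverse_mult_distrib)
    finally have "int (d + 1) * fls_subdegree \<pi> = int (d + 1) * 1"
      by (simp only: fls_subdegree_pow mult_1_right of_nat_add of_nat_1)
    then show ?thesis
      by (subst (asm) mult_left_cancel) auto
  qed
  \<comment> \<open>This makes \<open>\<delta>\<close> positive, on which both the subgroup property
    and the finite index rest.\<close>
  have \<xi>0: "\<xi> (ideal_a f d (d - 1 - l)) \<noteq> 0"
    using period_nonzero[OF C_inf ideal_a_lattice[OF a(3) f0] sub\<pi> \<xi>_ideal] df l
    by (simp add: vdeg_def)
  let ?\<alpha> = "j (to_ac \<alpha>)"
  have \<alpha>0: "?\<alpha> \<noteq> 0"
    using cabs_extends[of \<alpha>] \<alpha>(2) q1 cabs_zero by (auto simp: vabs_def)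
  have main: "finite (scaled ?\<alpha> L // coset_rel (scaled ?\<alpha> L) (Lambda_tilde ?\<alpha> \<delta> L)) \<and>
      (\<forall>R. nonzero_class_reps (scaled ?\<alpha> L) (Lambda_tilde ?\<alpha> \<delta> L) R \<longrightarrow>
        (\<forall>z. exp_lattice L (?\<alpha> * z) = ?\<alpha> * exp_lattice (Lambda_tilde ?\<alpha> \<delta> L) z *
          (\<Prod>w\<in>R. 1 - exp_lattice (Lambda_tilde ?\<alpha> \<delta> L) z / exp_lattice (Lambda_tilde ?\<alpha> \<delta> L) w)))"
    if \<delta>: "0 < \<delta>" and L_def: "L = Lambda_breve j \<xi> f (eps_Nl ?q d N l)" for N \<delta> L
  proof -
    define \<Lambda> where "\<Lambda> = Lambda f (real ?q powi (- int (d * N + l)))"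
    have L: "L = (\<lambda>x. \<xi> \<Lambda> * j (to_ac x)) ` \<Lambda>"
      by (simp add: L_def Lambda_breve_def eps_Nl_def \<Lambda>_def)
    \<comment> \<open>The scaled lattice is again a multiple of the image of
      \<open>\<Lambda>\<close>, so the lemmas on such images apply to it too.\<close>
    have scL: "scaled ?\<alpha> L = (\<lambda>x. (inverse ?\<alpha> * \<xi> \<Lambda>) * j (to_ac x)) ` \<Lambda>"
      by (simp add: scaled_def L image_image mult.assoc)
    have sub: "add_subgroup L" "add_subgroup (scaled ?\<alpha> L)"
      unfolding scL unfolding L \<Lambda>_def by (intro add_subgroup_image add_subgroup_Lambda)+
    have dis: "discrete (scaled ?\<alpha> L)"
      unfolding scL by (rule discrete_image) (auto simp: \<Lambda>_def Lambda_def)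
    have sub': "add_subgroup (Lambda_tilde ?\<alpha> \<delta> L)"
      by (rule add_subgroup_Lambda_tilde[OF sub \<delta>])
    have fin: "finite (scaled ?\<alpha> L // coset_rel (scaled ?\<alpha> L) (Lambda_tilde ?\<alpha> \<delta> L))"
      unfolding L \<Lambda>_def by (rule finite_index_Lambda_tilde[OF \<alpha>(2) \<delta>])
    have "exp_lattice L (?\<alpha> * z) = ?\<alpha> * exp_lattice (Lambda_tilde ?\<alpha> \<delta> L) z *
          (\<Prod>w\<in>R. 1 - exp_lattice (Lambda_tilde ?\<alpha> \<delta> L) z / exp_lattice (Lambda_tilde ?\<alpha> \<delta> L) w)"
      if R: "nonzero_class_reps (scaled ?\<alpha> L) (Lambda_tilde ?\<alpha> \<delta> L) R" for R z
    proof -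
      have "Lambda_tilde ?\<alpha> \<delta> L \<subseteq> scaled ?\<alpha> L" by (auto simp: Lambda_tilde_def)
      from exp_lattice_quotient[OF sub(2) dis this sub' R finite_nonzero_class_reps[OF sub' fin R]]
      show ?thesis
        by (simp add: exp_lattice_scaled[OF \<alpha>0] mult.assoc)
    qed
    with fin show ?thesis by blast
  qed
  show ?thesis
    unfolding Let_def
  \<comment> \<open>The threshold 1 is a convenient choice: \<open>main\<close> applies to each
    \<open>N\<close> once \<open>\<delta>\<close> is known to be positive.\<close>
  proof (intro exI[of _ 1] conjI allI impI, goal_cases)
    case (2 N)
    have "0 < real ?q powi (- int (d * N)) * eps_Nl ?q d N l * cabs (\<xi> (ideal_a f d (d - 1 - l)))"
      using q1 \<xi>0 by (simp add: eps_Nl_def)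
    from main[OF this refl] show ?case by blast
  next
    case (3 N R z)
    have "0 < real ?q powi (- int (d * N)) * eps_Nl ?q d N l * cabs (\<xi> (ideal_a f d (d - 1 - l)))"
      using q1 \<xi>0 by (simp add: eps_Nl_def)
    from main[OF this refl] 3 show ?case by blast
  qed simp
qed

end
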